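(* Let $(R,M)$ be a commutative Noetherian local ring, $N$ a finitely generated $R$-module, and $a=a_1,\dots,a_r\in M$ an $N$-regular sequence. Then $N$ is initially Cohen--Macaulay if and only if $N/aN$ is initially Cohen--Macaulay and $\mathrm{indim}\,N/aN=\mathrm{indim}\,N-r$.
   Context: The initial dimension of an $R$-module $N$ is $\mathrm{indim}\,N=\inf\{\dim R/P\mid P\in\mathrm{Ass}_R N\}$. A finitely generated $R$-module $N$ over a local ring is initially Cohen--Macaulay if $N=0$ or $\mathrm{depth}\,N=\mathrm{indim}\,N$. Here $aN=(a_1,\dots,a_r)N$. *)

theory Defs
  imports "HOL-Algebra.Algebra" "HOL-Library.Extended_Real"
begin

section \<open>Rings\<close>

definition local_ring :: "('a, 'r) ring_scheme \<Rightarrow> 'a set \<Rightarrow> bool" where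
  "local_ring R M \<longleftrightarrow> cring R \<and> maximalideal M R \<and> (\<forall>J. maximalideal J R \<longrightarrow> J = M)"

definition prime_chain :: "('a, 'r) ring_scheme \<Rightarrow> 'a set list \<Rightarrow> bool" where
  "prime_chain R Ps \<longleftrightarrow> Ps \<noteq> [] \<and> (\<forall>P\<in>set Ps. primeideal P R) \<and> sorted_wrt (\<subset>) Ps"

text \<open>A chain of \<open>n + 1\<close> primes has length \<open>n\<close>. The zero ring, which has no primes, gets
  dimension \<open>0\<close>; below, only rings \<open>R Quot P\<close> with \<open>P\<close> prime occur.\<close>
definition krull_dim :: "('a, 'r) ring_scheme \<Rightarrow> enat" where
  "krull_dim R = Sup {enat (length Ps - 1) | Ps. prime_chain R Ps}"

section \<open>Modules\<close>

definition zero_module :: "('a, 'b, 'n) module_scheme \<Rightarrow> bool" where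
  "zero_module N \<longleftrightarrow> carrier N = {\<zero>\<^bsub>N\<^esub>}"

definition module_span :: "('a, 'r) ring_scheme \<Rightarrow> ('a, 'b, 'n) module_scheme \<Rightarrow> 'b set \<Rightarrow> 'b set" where
  "module_span R N S = \<Inter>{L. submodule L R N \<and> S \<subseteq> L}"

definition fin_gen_module :: "('a, 'r) ring_scheme \<Rightarrow> ('a, 'b, 'n) module_scheme \<Rightarrow> bool" where
  "fin_gen_module R N \<longleftrightarrow>
     module R N \<and> (\<exists>S. finite S \<and> S \<subseteq> carrier N \<and> module_span R N S = carrier N)"

text \<open>The submodule \<open>I N\<close> for an ideal \<open>I\<close>.\<close>
definition ideal_smult :: "('a, 'r) ring_scheme \<Rightarrow> 'a set \<Rightarrow> ('a, 'b, 'n) module_scheme \<Rightarrow> 'b set" where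
  "ideal_smult R I N = module_span R N {x \<odot>\<^bsub>N\<^esub> n | x n. x \<in> I \<and> n \<in> carrier N}"

text \<open>The quotient \<open>N / L\<close> by a submodule \<open>L\<close>, built from cosets like \<^const>\<open>FactRing\<close>. The type of
  module records extends that of rings, so the fields \<open>mult\<close> and \<open>one\<close> have to be filled; the locale
  \<^locale>\<open>module\<close> does not look at them.\<close>
definition quot_module ::
    "('a, 'r) ring_scheme \<Rightarrow> ('a, 'b, 'n) module_scheme \<Rightarrow> 'b set \<Rightarrow> ('a, 'b set) module" where
  "quot_module R N L =
     \<lparr>carrier = a_rcosets\<^bsub>N\<^esub> L, monoid.mult = undefined, one = undefined, ring.zero = L, ring.add = set_add N,
      smult = (\<lambda>x C. \<Union>n\<in>C. L +>\<^bsub>N\<^esub> (x \<odot>\<^bsub>N\<^esub> n))\<rparr>"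

text \<open>\<open>N / (a\<^sub>1, \<dots>, a\<^sub>r) N\<close>.\<close>
definition quot_seq ::
    "('a, 'r) ring_scheme \<Rightarrow> ('a, 'b, 'n) module_scheme \<Rightarrow> 'a list \<Rightarrow> ('a, 'b set) module" where
  "quot_seq R N as = quot_module R N (ideal_smult R (Idl\<^bsub>R\<^esub> (set as)) N)"

definition annihilator :: "('a, 'r) ring_scheme \<Rightarrow> ('a, 'b, 'n) module_scheme \<Rightarrow> 'b \<Rightarrow> 'a set" where
  "annihilator R N n = {x \<in> carrier R. x \<odot>\<^bsub>N\<^esub> n = \<zero>\<^bsub>N\<^esub>}"

definition Ass :: "('a, 'r) ring_scheme \<Rightarrow> ('a, 'b, 'n) module_scheme \<Rightarrow> 'a set set" where
  "Ass R N = {P. primeideal P R \<and> (\<exists>n\<in>carrier N. P = annihilator R N n)}"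

section \<open>Regular sequences and depth\<close>

definition nonzerodivisor_on :: "('a, 'r) ring_scheme \<Rightarrow> ('a, 'b, 'n) module_scheme \<Rightarrow> 'a \<Rightarrow> bool" where
  "nonzerodivisor_on R N x \<longleftrightarrow>
     x \<in> carrier R \<and> (\<forall>n\<in>carrier N. x \<odot>\<^bsub>N\<^esub> n = \<zero>\<^bsub>N\<^esub> \<longrightarrow> n = \<zero>\<^bsub>N\<^esub>)"

text \<open>As usual, \<open>N \<noteq> a N\<close> is part of the definition; in particular \<open>0\<close> has no regular sequences,
  not even the empty one.\<close>
definition regular_seq :: "('a, 'r) ring_scheme \<Rightarrow> ('a, 'b, 'n) module_scheme \<Rightarrow> 'a list \<Rightarrow> bool" where
  "regular_seq R N as \<longleftrightarrow>
     (\<forall>i<length as. nonzerodivisor_on R (quot_seq R N (take i as)) (as ! i)) \<and>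
     \<not> zero_module (quot_seq R N as)"

text \<open>Depth over a local ring \<open>(R, M)\<close>, with the usual convention \<open>depth 0 = \<infinity>\<close>.\<close>
definition depth :: "('a, 'r) ring_scheme \<Rightarrow> 'a set \<Rightarrow> ('a, 'b, 'n) module_scheme \<Rightarrow> enat" where
  "depth R M N =
     (if zero_module N then \<infinity> else Sup {enat (length as) | as. set as \<subseteq> M \<and> regular_seq R N as})"

section \<open>Initially Cohen--Macaulay modules\<close>

text \<open>The infimum of the empty set is \<open>\<infinity>\<close> in \<^typ>\<open>enat\<close>.\<close>
definition indim :: "('a, 'r) ring_scheme \<Rightarrow> ('a, 'b, 'n) module_scheme \<Rightarrow> enat" where
  "indim R N = Inf {krull_dim (R Quot P) | P. P \<in> Ass R N}"

definition initially_CM :: "('a, 'r) ring_scheme \<Rightarrow> 'a set \<Rightarrow> ('a, 'b, 'n) module_scheme \<Rightarrow> bool" where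
  "initially_CM R M N \<longleftrightarrow> zero_module N \<or> depth R M N = indim R N"

end

theory Submission
  imports Defs
begin

text \<open>Write \<open>r\<close> for the length of the sequence. The theorem follows from three facts:
  \<open>depth N = depth (N/aN) + r\<close>, \<open>indim (N/aN) + r \<le> indim N\<close>, and hence (apply the second fact to
  all regular sequences) \<open>depth N \<le> indim N\<close>. No finiteness of dimensions is needed.

  For the second fact, let \<open>x\<close> be \<open>N\<close>-regular and \<open>P \<in> Ass N\<close>. If the submodule \<open>U\<close> of elements
  annihilated by \<open>P\<close> were contained in \<open>xN\<close>, then \<open>U = xU\<close>, contradicting Nakayama's lemma; so some
  associated prime of \<open>N/xN\<close> contains \<open>P\<close> and \<open>x \<notin> P\<close>.

  The first fact rests on an exchange argument that avoids homological algebra: if \<open>b\<^sub>1, \<dots>, b\<^sub>s\<close> and \<open>x\<close>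
  are \<open>N\<close>-regular, prime avoidance gives a \<open>y\<close> that is regular on both \<open>N/b\<^sub>1N\<close> and \<open>N/xN\<close>, and
  induction on \<open>s\<close>, first for \<open>N/b\<^sub>1N\<close> and then for \<open>N/yN\<close>, yields a regular sequence of length
  \<open>s - 1\<close> on \<open>N/xN\<close> that starts with \<open>y\<close>.\<close>

section \<open>Submodules of modules over Noetherian rings\<close>

text \<open>The larger ideal counts as the smaller element, so \<open>wfE_min\<close> picks maximal
  members of families of ideals. An infinite strictly ascending sequence would be a chain whose
  union is one of its members \<open>f k\<close>, against
  \<open>f k \<subset> f (Suc k)\<close>.\<close>

lemma (in noetherian_ring) wf_ideals:
  "wf {(J, I). ideal I R \<and> ideal J R \<and> I \<subset> J}"
  unfolding wf_iff_no_infinite_down_chain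
proof
  assume "\<exists>f. \<forall>i. (f (Suc i), f i) \<in> {(J, I). ideal I R \<and> ideal J R \<and> I \<subset> J}"
  then obtain f where f: "ideal (f i) R" "f i \<subset> f (Suc i)" for i
    by blast
  have mono: "f i \<subseteq> f j" if "i \<le> j" for i j
    using lift_Suc_mono_le[of f] f(2) that by blast
  have "subset.chain {I. ideal I R} (range f)"
    unfolding pred_on.chain_def using f(1) mono nat_le_linear by blast
  then have "\<Union> (range f) \<in> range f"
    by (intro ideal_chain_is_trivial) auto
  then obtain k where "\<Union> (range f) = f k"
    by blast
  then show False
    using f(2)[of k] by blast
qed

text \<open>The annihilator of the class of \<open>n\<close> in \<open>N / L\<close>.\<close>

definition colon :: "('a, 'r) ring_scheme \<Rightarrow> ('a, 'b, 'n) module_scheme \<Rightarrow> 'b set \<Rightarrow> 'b \<Rightarrow> 'a set" where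
  "colon R N L n = {c \<in> carrier R. c \<odot>\<^bsub>N\<^esub> n \<in> L}"

context module
begin

section \<open>Arithmetic of submodules, spans and colon ideals\<close>

lemma submodule_carrier: "submodule L R M \<Longrightarrow> n \<in> L \<Longrightarrow> n \<in> carrier M"
  using submoduleE(1) by blast

lemma submodule_zero: "submodule L R M \<Longrightarrow> \<zero>\<^bsub>M\<^esub> \<in> L"
  using subgroup.one_closed[OF submodule.axioms(1)] by fastforce

lemmas submodule_add = submoduleE(5) and submodule_smult = submoduleE(4)
  and submodule_uminus = submoduleE(3)

lemma submodule_minus: "submodule L R M \<Longrightarrow> m \<in> L \<Longrightarrow> n \<in> L \<Longrightarrow> m \<ominus>\<^bsub>M\<^esub> n \<in> L"
  by (simp add: a_minus_def submodule_add submodule_uminus)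

lemma submodule_add_iff:
  assumes L: "submodule L R M" and l: "l \<in> L" and n: "n \<in> carrier M"
  shows "l \<oplus>\<^bsub>M\<^esub> n \<in> L \<longleftrightarrow> n \<in> L"
proof
  assume *: "l \<oplus>\<^bsub>M\<^esub> n \<in> L"
  have "n = \<ominus>\<^bsub>M\<^esub> l \<oplus>\<^bsub>M\<^esub> (l \<oplus>\<^bsub>M\<^esub> n)"
    using submodule_carrier[OF L l] n by (simp add: M.r_neg1 M.r_neg2)
  then show "n \<in> L"
    using * l by (metis L submodule_add submodule_uminus)
qed (use L l submodule_add in blast)

lemma submodule_minus_iff:
  assumes L: "submodule L R M" and n: "n \<in> carrier M" "m \<in> carrier M" and d: "m \<ominus>\<^bsub>M\<^esub> n \<in> L"
  shows "m \<in> L \<longleftrightarrow> n \<in> L"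
proof -
  have "m = (m \<ominus>\<^bsub>M\<^esub> n) \<oplus>\<^bsub>M\<^esub> n"
    using n by (simp add: a_minus_def M.a_assoc M.l_neg)
  then show ?thesis
    using submodule_add_iff[OF L d n(1)] by simp
qed

lemma smult_minus:
  assumes "c \<in> carrier R" "m \<in> carrier M" "n \<in> carrier M"
  shows "c \<odot>\<^bsub>M\<^esub> (m \<ominus>\<^bsub>M\<^esub> n) = c \<odot>\<^bsub>M\<^esub> m \<ominus>\<^bsub>M\<^esub> c \<odot>\<^bsub>M\<^esub> n"
  using assms by (simp add: a_minus_def smult_r_distr smult_r_minus)

lemma smult_commute:
  assumes "c \<in> carrier R" "d \<in> carrier R" "n \<in> carrier M"
  shows "c \<odot>\<^bsub>M\<^esub> (d \<odot>\<^bsub>M\<^esub> n) = d \<odot>\<^bsub>M\<^esub> (c \<odot>\<^bsub>M\<^esub> n)"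
  using assms by (metis smult_assoc1 m_comm)

lemma submodule_set_add:
  assumes L: "submodule L R M" and K: "submodule K R M"
  shows "submodule (L <+>\<^bsub>M\<^esub> K) R M"
proof (rule submoduleI)
  note c = submodule_carrier[OF L] submodule_carrier[OF K]
  show "L <+>\<^bsub>M\<^esub> K \<subseteq> carrier M"
    using c by (auto simp: set_add_def')
  show "\<zero>\<^bsub>M\<^esub> \<in> L <+>\<^bsub>M\<^esub> K"
    using submodule_zero[OF L] submodule_zero[OF K] by (force simp: set_add_def')
  show "\<ominus>\<^bsub>M\<^esub> a \<in> L <+>\<^bsub>M\<^esub> K" if "a \<in> L <+>\<^bsub>M\<^esub> K" for a
  proof -
    from that obtain l k where "l \<in> L" "k \<in> K" "a = l \<oplus>\<^bsub>M\<^esub> k"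
      by (auto simp: set_add_def')
    moreover from this have "\<ominus>\<^bsub>M\<^esub> a = \<ominus>\<^bsub>M\<^esub> l \<oplus>\<^bsub>M\<^esub> \<ominus>\<^bsub>M\<^esub> k"
      using c by (simp add: M.minus_add)
    ultimately show ?thesis
      using submodule_uminus[OF L] submodule_uminus[OF K] by (auto simp: set_add_def')
  qed
  show "a \<oplus>\<^bsub>M\<^esub> b \<in> L <+>\<^bsub>M\<^esub> K" if ab: "a \<in> L <+>\<^bsub>M\<^esub> K" "b \<in> L <+>\<^bsub>M\<^esub> K" for a b
  proof -
    from ab obtain l k l' k' where 1: "l \<in> L" "k \<in> K" "l' \<in> L" "k' \<in> K"
      and 2: "a = l \<oplus>\<^bsub>M\<^esub> k" "b = l' \<oplus>\<^bsub>M\<^esub> k'"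
      by (auto simp: set_add_def')
    have "a \<oplus>\<^bsub>M\<^esub> b = (l \<oplus>\<^bsub>M\<^esub> l') \<oplus>\<^bsub>M\<^esub> (k \<oplus>\<^bsub>M\<^esub> k')"
      using 1 c by (simp add: 2 M.a_ac)
    then show ?thesis
      using submodule_add[OF L 1(1,3)] submodule_add[OF K 1(2,4)] by (auto simp: set_add_def')
  qed
  show "c \<odot>\<^bsub>M\<^esub> a \<in> L <+>\<^bsub>M\<^esub> K" if a: "c \<in> carrier R" "a \<in> L <+>\<^bsub>M\<^esub> K" for c a
  proof -
    from a obtain l k where 1: "l \<in> L" "k \<in> K" "a = l \<oplus>\<^bsub>M\<^esub> k"
      by (auto simp: set_add_def')
    then have "c \<odot>\<^bsub>M\<^esub> a = c \<odot>\<^bsub>M\<^esub> l \<oplus>\<^bsub>M\<^esub> c \<odot>\<^bsub>M\<^esub> k"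
      using a(1) c by (simp add: smult_r_distr)
    then show ?thesis
      using submodule_smult[OF L a(1) 1(1)] submodule_smult[OF K a(1) 1(2)] by (auto simp: set_add_def')
  qed
qed

lemma set_add_upper:
  assumes L: "submodule L R M" and K: "submodule K R M"
  shows "L \<subseteq> L <+>\<^bsub>M\<^esub> K" and "K \<subseteq> L <+>\<^bsub>M\<^esub> K"
proof -
  show "L \<subseteq> L <+>\<^bsub>M\<^esub> K"
  proof
    fix l assume "l \<in> L"
    then have "l = l \<oplus>\<^bsub>M\<^esub> \<zero>\<^bsub>M\<^esub>"
      using submodule_carrier[OF L] by simp
    with \<open>l \<in> L\<close> show "l \<in> L <+>\<^bsub>M\<^esub> K"
      using submodule_zero[OF K] by (auto simp: set_add_def')
  qed
  show "K \<subseteq> L <+>\<^bsub>M\<^esub> K"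
  proof
    fix k assume "k \<in> K"
    then have "k = \<zero>\<^bsub>M\<^esub> \<oplus>\<^bsub>M\<^esub> k"
      using submodule_carrier[OF K] by simp
    with \<open>k \<in> K\<close> show "k \<in> L <+>\<^bsub>M\<^esub> K"
      using submodule_zero[OF L] by (auto simp: set_add_def')
  qed
qed

lemma set_add_least:
  assumes "submodule U R M" "L \<subseteq> U" "K \<subseteq> U"
  shows "L <+>\<^bsub>M\<^esub> K \<subseteq> U"
  using assms submodule_add[OF assms(1)] by (auto simp: set_add_def')

lemma submodule_Int:
  assumes L: "submodule L R M" and K: "submodule K R M"
  shows "submodule (L \<inter> K) R M"
  using submodule_carrier[OF L] submodule_zero[OF L] submodule_zero[OF K]
  by (intro submoduleI)
    (auto intro: submodule_uminus[OF L] submodule_uminus[OF K] submodule_add[OF L] submodule_add[OF K]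
      submodule_smult[OF L] submodule_smult[OF K])

lemma submodule_zero_module: "submodule {\<zero>\<^bsub>M\<^esub>} R M"
  by (rule submoduleI) auto

lemma submodule_cyclic:
  assumes n: "n \<in> carrier M"
  shows "submodule ((\<lambda>c. c \<odot>\<^bsub>M\<^esub> n) ` carrier R) R M"
proof (rule submoduleI)
  show "\<zero>\<^bsub>M\<^esub> \<in> (\<lambda>c. c \<odot>\<^bsub>M\<^esub> n) ` carrier R"
    using n by (auto intro!: image_eqI[of _ _ \<zero>])
  show "\<ominus>\<^bsub>M\<^esub> a \<in> (\<lambda>c. c \<odot>\<^bsub>M\<^esub> n) ` carrier R" if "a \<in> (\<lambda>c. c \<odot>\<^bsub>M\<^esub> n) ` carrier R" for a
    using that n by (auto simp: smult_l_minus[symmetric])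
  show "a \<oplus>\<^bsub>M\<^esub> b \<in> (\<lambda>c. c \<odot>\<^bsub>M\<^esub> n) ` carrier R"
    if "a \<in> (\<lambda>c. c \<odot>\<^bsub>M\<^esub> n) ` carrier R" "b \<in> (\<lambda>c. c \<odot>\<^bsub>M\<^esub> n) ` carrier R" for a b
    using that n by (auto simp: smult_l_distr[symmetric])
  show "d \<odot>\<^bsub>M\<^esub> a \<in> (\<lambda>c. c \<odot>\<^bsub>M\<^esub> n) ` carrier R"
    if "d \<in> carrier R" "a \<in> (\<lambda>c. c \<odot>\<^bsub>M\<^esub> n) ` carrier R" for d a
    using that n by (auto simp: smult_assoc1[symmetric])
qed (use n in auto)

lemma submodule_multiples:
  assumes a: "a \<in> carrier R"
  shows "submodule ((\<lambda>n. a \<odot>\<^bsub>M\<^esub> n) ` carrier M) R M"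
proof (rule submoduleI)
  show "\<zero>\<^bsub>M\<^esub> \<in> (\<lambda>n. a \<odot>\<^bsub>M\<^esub> n) ` carrier M"
    using a by (auto intro!: image_eqI[of _ _ "\<zero>\<^bsub>M\<^esub>"])
  show "\<ominus>\<^bsub>M\<^esub> m \<in> (\<lambda>n. a \<odot>\<^bsub>M\<^esub> n) ` carrier M" if "m \<in> (\<lambda>n. a \<odot>\<^bsub>M\<^esub> n) ` carrier M" for m
    using that a by (auto simp: smult_r_minus[symmetric])
  show "m \<oplus>\<^bsub>M\<^esub> n \<in> (\<lambda>n. a \<odot>\<^bsub>M\<^esub> n) ` carrier M"
    if "m \<in> (\<lambda>n. a \<odot>\<^bsub>M\<^esub> n) ` carrier M" "n \<in> (\<lambda>n. a \<odot>\<^bsub>M\<^esub> n) ` carrier M" for m n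
    using that a by (auto simp: smult_r_distr[symmetric])
  show "d \<odot>\<^bsub>M\<^esub> m \<in> (\<lambda>n. a \<odot>\<^bsub>M\<^esub> n) ` carrier M"
    if "d \<in> carrier R" "m \<in> (\<lambda>n. a \<odot>\<^bsub>M\<^esub> n) ` carrier M" for d m
    using that a by (auto simp: smult_commute[of d a])
qed (use a in auto)

lemma cyclic_self: "n \<in> carrier M \<Longrightarrow> n \<in> (\<lambda>c. c \<odot>\<^bsub>M\<^esub> n) ` carrier R"
  by (auto intro!: image_eqI[of _ _ \<one>])

lemma module_span_submodule: "S \<subseteq> carrier M \<Longrightarrow> submodule (module_span R M S) R M"
  unfolding module_span_def
  using carrier_is_submodule
  by (intro submoduleI)
    (auto intro: submodule_zero submodule_carrier submodule_uminus submodule_add submodule_smult)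

lemma module_span_superset: "S \<subseteq> module_span R M S"
  by (auto simp: module_span_def)

lemma module_span_least: "submodule L R M \<Longrightarrow> S \<subseteq> L \<Longrightarrow> module_span R M S \<subseteq> L"
  by (auto simp: module_span_def)

lemma module_span_insert_subset:
  assumes "s \<in> carrier M" "S \<subseteq> carrier M"
  shows "module_span R M (insert s S) \<subseteq> module_span R M S <+>\<^bsub>M\<^esub> (\<lambda>c. c \<odot>\<^bsub>M\<^esub> s) ` carrier R"
proof (rule module_span_least)
  note sub = module_span_submodule[OF assms(2)] submodule_cyclic[OF assms(1)]
  show "submodule (module_span R M S <+>\<^bsub>M\<^esub> (\<lambda>c. c \<odot>\<^bsub>M\<^esub> s) ` carrier R) R M"
    by (rule submodule_set_add[OF sub])
  show "insert s S \<subseteq> module_span R M S <+>\<^bsub>M\<^esub> (\<lambda>c. c \<odot>\<^bsub>M\<^esub> s) ` carrier R"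
    using set_add_upper[OF sub] cyclic_self[OF assms(1)] module_span_superset[of S] by auto
qed

lemma ideal_colon:
  assumes L: "submodule L R M" and n: "n \<in> carrier M"
  shows "ideal (colon R M L n) R"
proof (rule idealI)
  show "subgroup (colon R M L n) (add_monoid R)"
    using n submodule_zero[OF L] submodule_add[OF L] submodule_uminus[OF L]
    by (intro subgroup.intro) (auto simp: colon_def smult_l_distr smult_l_minus simp flip: a_inv_def)
  show "x \<otimes> a \<in> colon R M L n" if "a \<in> colon R M L n" "x \<in> carrier R" for a x
    using that n submodule_smult[OF L] by (auto simp: colon_def smult_assoc1)
  then show "a \<otimes> x \<in> colon R M L n" if "a \<in> colon R M L n" "x \<in> carrier R" for a x
    using that by (metis (no_types, lifting) colon_def m_comm mem_Collect_eq)
qed (rule R.ring_axioms)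

lemma one_in_colon_iff: "n \<in> carrier M \<Longrightarrow> \<one> \<in> colon R M L n \<longleftrightarrow> n \<in> L"
  by (auto simp: colon_def)

lemma colon_smult_superset:
  assumes L: "submodule L R M" and n: "n \<in> carrier M" and c: "c \<in> carrier R"
  shows "colon R M L n \<subseteq> colon R M L (c \<odot>\<^bsub>M\<^esub> n)"
  using assms submodule_smult[OF L c] by (auto simp: colon_def smult_commute[of _ c])

text \<open>The ascending chain condition passes from ideals to finitely generated modules by
  induction on the generators. Bounding submodules of the fixed module \<open>M\<close> by a span
  lets the induction run without changing the module.\<close>

lemma wf_submodules_below_span:
  assumes "noetherian_ring R" "finite S" "S \<subseteq> carrier M"
  shows "wf {(L', L). submodule L R M \<and> submodule L' R M \<and> L \<subset> L' \<and> L' \<subseteq> module_span R M S}"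
  using assms(2,3)
proof (induction S)
  case empty
  have "module_span R M {} \<subseteq> {\<zero>\<^bsub>M\<^esub>}"
    by (rule module_span_least[OF submodule_zero_module]) simp
  \<comment> \<open>Both submodules contain zero and lie in the zero module, so no strict inclusion
    is left.\<close>
  then have "{(L', L). submodule L R M \<and> submodule L' R M \<and> L \<subset> L' \<and> L' \<subseteq> module_span R M {}} = {}"
    using submodule_zero by blast
  moreover have "wf ({} :: ('c set \<times> 'c set) set)"
    by simp
  ultimately show ?case by (simp only:)
next
  case (insert s S)
  define T where "T = module_span R M S"
  \<comment> \<open>\<open>I L\<close> collects the coefficients of the new generator
    \<open>s\<close> that occur in elements of \<open>L\<close> modulo \<open>T\<close>.\<close>
  define I where "I L = colon R M (L <+>\<^bsub>M\<^esub> T) s" for L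
  define r where "r = {(J, I). ideal I R \<and> ideal J R \<and> I \<subset> J}"
  define q where "q = {(L', L). submodule L R M \<and> submodule L' R M \<and> L \<subset> L' \<and> L' \<subseteq> T}"
  have s: "s \<in> carrier M" and T: "submodule T R M"
    using insert.prems module_span_submodule by (auto simp: T_def)
  \<comment> \<open>Nested submodules \<open>L \<subseteq> L'\<close> of \<open>span (insert s S)\<close> with \<open>I L = I L'\<close> and \<open>L \<inter> T = L' \<inter> T\<close>
    coincide, so \<open>L \<mapsto> (I L, L \<inter> T)\<close> is strictly monotone.\<close>
  have "wf (r <*lex*> q)"
    using noetherian_ring.wf_ideals[OF assms(1)] insert.IH insert.prems
    unfolding r_def q_def T_def by (intro wf_lex_prod) auto
  then have wf: "wf (inv_image (r <*lex*> q) (\<lambda>L. (I L, L \<inter> T)))"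
    by (rule wf_inv_image)
  have "(L', L) \<in> inv_image (r <*lex*> q) (\<lambda>L. (I L, L \<inter> T))"
    if L: "submodule L R M" and L': "submodule L' R M" and LL': "L \<subset> L'"
      and sp: "L' \<subseteq> module_span R M (insert s S)" for L L'
  proof -
    have id: "ideal (I L) R" "ideal (I L') R"
      using ideal_colon submodule_set_add s T L L' by (auto simp: I_def)
    have "L <+>\<^bsub>M\<^esub> T \<subseteq> L' <+>\<^bsub>M\<^esub> T"
      using LL' by (auto simp: set_add_def')
    then have sub: "I L \<subseteq> I L'"
      by (auto simp: I_def colon_def)
    have "L' \<subseteq> L" if eqI: "I L = I L'" and eqT: "L \<inter> T = L' \<inter> T"
    proof
      fix n assume n: "n \<in> L'"
      then have "n \<in> T <+>\<^bsub>M\<^esub> (\<lambda>c. c \<odot>\<^bsub>M\<^esub> s) ` carrier R"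
        using sp module_span_insert_subset[of s S] insert.prems unfolding T_def by blast
      then obtain t c where t: "t \<in> T" and c: "c \<in> carrier R" and nt: "n = t \<oplus>\<^bsub>M\<^esub> c \<odot>\<^bsub>M\<^esub> s"
        by (auto simp: set_add_def')
      note cr = submodule_carrier[OF T] submodule_carrier[OF L] submodule_carrier[OF L']
      have "c \<odot>\<^bsub>M\<^esub> s = n \<oplus>\<^bsub>M\<^esub> \<ominus>\<^bsub>M\<^esub> t"
        using cr(1)[OF t] c s by (simp add: nt M.a_ac M.r_neg1 M.r_neg2)
      then have "c \<in> I L'"
        using n submodule_uminus[OF T t] c by (auto simp: I_def colon_def set_add_def')
      then have "c \<in> I L"
        using eqI by simp
      then obtain l t' where l: "l \<in> L" and t': "t' \<in> T" and cs: "c \<odot>\<^bsub>M\<^esub> s = l \<oplus>\<^bsub>M\<^esub> t'"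
        by (auto simp: I_def colon_def set_add_def')
      have n2: "n = l \<oplus>\<^bsub>M\<^esub> (t \<oplus>\<^bsub>M\<^esub> t')"
        using cr l t t' by (simp add: nt cs M.a_ac)
      have tt: "t \<oplus>\<^bsub>M\<^esub> t' \<in> T"
        using submodule_add[OF T t t'] .
      moreover have "t \<oplus>\<^bsub>M\<^esub> t' \<in> L'"
        using submodule_add_iff[OF L', of l "t \<oplus>\<^bsub>M\<^esub> t'"] n n2 l LL' cr(1)[OF tt] by auto
      ultimately have "t \<oplus>\<^bsub>M\<^esub> t' \<in> L"
        using eqT by blast
      then show "n \<in> L"
        using submodule_add[OF L l] n2 by simp
    qed
    then show ?thesis
      using sub id LL' submodule_Int[OF L T] submodule_Int[OF L' T] by (auto simp: r_def q_def)
  qed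
  then show ?case
    by (intro wf_subset[OF wf] subsetI) (clarify, blast)
qed

end

lemma wf_submodules:
  assumes "noetherian_ring R" "fin_gen_module R N"
  shows "wf {(L', L). submodule L R N \<and> submodule L' R N \<and> L \<subset> L'}"
proof -
  from assms(2) obtain S where "module R N" and S: "finite S" "S \<subseteq> carrier N" "module_span R N S = carrier N"
    by (auto simp: fin_gen_module_def)
  interpret module R N by fact
  show ?thesis
    using wf_submodules_below_span[OF assms(1) S(1,2)] unfolding S(3)
    by (rule wf_subset) (auto dest: submodule_carrier)
qed

section \<open>Regular sequences and associated primes relative to a submodule\<close>

text \<open>Iterated quotients of a module live in ever larger types, which rules out induction on them.
  Statements about \<open>N / L\<close> are therefore phrased inside \<open>N\<close>, in terms of the submodule \<open>L\<close>; the
  quotient of \<open>N / L\<close> by \<open>A (N / L)\<close> corresponds to the submodule \<open>L + A N\<close>.\<close>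

definition add_mult :: "('a, 'r) ring_scheme \<Rightarrow> ('a, 'b, 'n) module_scheme \<Rightarrow> 'b set \<Rightarrow> 'a set \<Rightarrow> 'b set" where
  "add_mult R N L A = module_span R N (L \<union> {a \<odot>\<^bsub>N\<^esub> n | a n. a \<in> A \<and> n \<in> carrier N})"

definition nzd_mod :: "('a, 'r) ring_scheme \<Rightarrow> ('a, 'b, 'n) module_scheme \<Rightarrow> 'b set \<Rightarrow> 'a \<Rightarrow> bool" where
  "nzd_mod R N L x \<longleftrightarrow> x \<in> carrier R \<and> (\<forall>n\<in>carrier N. x \<odot>\<^bsub>N\<^esub> n \<in> L \<longrightarrow> n \<in> L)"

definition regular_mod :: "('a, 'r) ring_scheme \<Rightarrow> ('a, 'b, 'n) module_scheme \<Rightarrow> 'b set \<Rightarrow> 'a list \<Rightarrow> bool" where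
  "regular_mod R N L as \<longleftrightarrow>
     (\<forall>i<length as. nzd_mod R N (add_mult R N L (set (take i as))) (as ! i)) \<and>
     add_mult R N L (set as) \<noteq> carrier N"

definition assoc_mod :: "('a, 'r) ring_scheme \<Rightarrow> ('a, 'b, 'n) module_scheme \<Rightarrow> 'b set \<Rightarrow> 'a set set" where
  "assoc_mod R N L = {P. primeideal P R \<and> (\<exists>n\<in>carrier N. P = colon R N L n)}"

lemma nzd_modD: "nzd_mod R N L x \<Longrightarrow> n \<in> carrier N \<Longrightarrow> x \<odot>\<^bsub>N\<^esub> n \<in> L \<Longrightarrow> n \<in> L"
  by (simp add: nzd_mod_def)

context module
begin

section \<open>The submodules \<open>L + A M\<close> and the recursion for regular sequences\<close>

lemma add_mult_submodule:
  assumes "submodule L R M" "A \<subseteq> carrier R"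
  shows "submodule (add_mult R M L A) R M"
  unfolding add_mult_def using assms submodule_carrier by (intro module_span_submodule) auto

lemma add_mult_superset: "L \<subseteq> add_mult R M L A"
  unfolding add_mult_def by (rule order_trans[OF _ module_span_superset]) simp

lemma smult_in_add_mult: "a \<in> A \<Longrightarrow> n \<in> carrier M \<Longrightarrow> a \<odot>\<^bsub>M\<^esub> n \<in> add_mult R M L A"
  unfolding add_mult_def by (rule subsetD[OF module_span_superset]) auto

lemma add_mult_least:
  assumes "submodule U R M" "L \<subseteq> U" "\<And>a n. a \<in> A \<Longrightarrow> n \<in> carrier M \<Longrightarrow> a \<odot>\<^bsub>M\<^esub> n \<in> U"
  shows "add_mult R M L A \<subseteq> U"
  unfolding add_mult_def using assms by (intro module_span_least) auto

lemma add_mult_empty: "submodule L R M \<Longrightarrow> add_mult R M L {} = L"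
  by (intro equalityI add_mult_superset add_mult_least) auto

text \<open>Stands in for the isomorphism between an iterated quotient and a single one. It also
  makes the order in which elements are divided out irrelevant.\<close>

lemma add_mult_Un:
  assumes L: "submodule L R M" and AB: "A \<subseteq> carrier R" "B \<subseteq> carrier R"
  shows "add_mult R M (add_mult R M L A) B = add_mult R M L (A \<union> B)"
proof
  have sub: "submodule (add_mult R M L (A \<union> B)) R M"
    using add_mult_submodule L AB by simp
  have sub': "submodule (add_mult R M (add_mult R M L A) B) R M"
    using add_mult_submodule L AB by simp
  have "add_mult R M L A \<subseteq> add_mult R M L (A \<union> B)"
    by (intro add_mult_least sub add_mult_superset smult_in_add_mult) auto
  then show "add_mult R M (add_mult R M L A) B \<subseteq> add_mult R M L (A \<union> B)"
    by (intro add_mult_least[of _ "add_mult R M L A"] sub smult_in_add_mult) auto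
  show "add_mult R M L (A \<union> B) \<subseteq> add_mult R M (add_mult R M L A) B"
  proof (intro add_mult_least sub')
    show "L \<subseteq> add_mult R M (add_mult R M L A) B"
      using order_trans[OF add_mult_superset add_mult_superset] .
    show "a \<odot>\<^bsub>M\<^esub> n \<in> add_mult R M (add_mult R M L A) B" if "a \<in> A \<union> B" "n \<in> carrier M" for a n
      using that smult_in_add_mult[of a A n L] smult_in_add_mult[of a B n]
        add_mult_superset[of "add_mult R M L A" B] by blast
  qed
qed

lemma add_mult_insert:
  assumes "submodule L R M" "a \<in> carrier R" "A \<subseteq> carrier R"
  shows "add_mult R M L (insert a A) = add_mult R M (add_mult R M L {a}) A"
  using add_mult_Un[of L "{a}" A] assms by simp

lemma add_mult_single:
  assumes L: "submodule L R M" and a: "a \<in> carrier R"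
  shows "add_mult R M L {a} = L <+>\<^bsub>M\<^esub> (\<lambda>n. a \<odot>\<^bsub>M\<^esub> n) ` carrier M"
proof
  note sub = L submodule_multiples[OF a]
  show "add_mult R M L {a} \<subseteq> L <+>\<^bsub>M\<^esub> (\<lambda>n. a \<odot>\<^bsub>M\<^esub> n) ` carrier M"
    using set_add_upper[OF sub] by (intro add_mult_least submodule_set_add sub) auto
  show "L <+>\<^bsub>M\<^esub> (\<lambda>n. a \<odot>\<^bsub>M\<^esub> n) ` carrier M \<subseteq> add_mult R M L {a}"
    using smult_in_add_mult[of a "{a}"] add_mult_superset[of L "{a}"] a
    by (intro set_add_least add_mult_submodule L) auto
qed

lemma add_mult_singleE:
  assumes "submodule L R M" "a \<in> carrier R" "m \<in> add_mult R M L {a}"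
  obtains n where "n \<in> carrier M" "m \<ominus>\<^bsub>M\<^esub> a \<odot>\<^bsub>M\<^esub> n \<in> L"
proof -
  from assms obtain l n where l: "l \<in> L" "n \<in> carrier M" "m = l \<oplus>\<^bsub>M\<^esub> a \<odot>\<^bsub>M\<^esub> n"
    by (auto simp: add_mult_single set_add_def')
  then have "m \<ominus>\<^bsub>M\<^esub> a \<odot>\<^bsub>M\<^esub> n = l"
    using submodule_carrier[OF assms(1)] assms(2) by (simp add: a_minus_def M.a_assoc M.r_neg)
  with l that show thesis by simp
qed

lemma add_mult_singleI:
  assumes "submodule L R M" "a \<in> carrier R" "n \<in> carrier M" "m \<in> carrier M"
    and "m \<ominus>\<^bsub>M\<^esub> a \<odot>\<^bsub>M\<^esub> n \<in> L"
  shows "m \<in> add_mult R M L {a}"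
  using submodule_minus_iff[OF add_mult_submodule[of L "{a}"], of "a \<odot>\<^bsub>M\<^esub> n" m]
    assms add_mult_superset[of L "{a}"] smult_in_add_mult[of a "{a}" n L] by blast

lemma regular_mod_Nil: "submodule L R M \<Longrightarrow> regular_mod R M L [] \<longleftrightarrow> L \<noteq> carrier M"
  by (simp add: regular_mod_def add_mult_empty)

text \<open>Index 0 of the quantifier gives the condition on \<open>b\<close>, the remaining indices
  shift by \<open>add_mult_insert\<close>. Inductions along a sequence use this in place of the
  passage from a module to its quotient by \<open>b\<close>.\<close>

lemma regular_mod_Cons:
  assumes L: "submodule L R M" and "b \<in> carrier R" "set bs \<subseteq> carrier R"
  shows "regular_mod R M L (b # bs) \<longleftrightarrow> nzd_mod R M L b \<and> regular_mod R M (add_mult R M L {b}) bs"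
proof -
  have "set (take i bs) \<subseteq> carrier R" for i
    using assms(3) set_take_subset by fastforce
  then have "add_mult R M L (insert b (set (take i bs))) = add_mult R M (add_mult R M L {b}) (set (take i bs))" for i
    using add_mult_insert assms by blast
  moreover have "add_mult R M L (insert b (set bs)) = add_mult R M (add_mult R M L {b}) (set bs)"
    using add_mult_insert assms by blast
  ultimately show ?thesis
    using L by (simp add: regular_mod_def All_less_Suc2 add_mult_empty conj_assoc)
qed

lemma regular_mod_neq_carrier:
  assumes "submodule L R M" "set bs \<subseteq> carrier R" "regular_mod R M L bs"
  shows "L \<noteq> carrier M"
  using assms add_mult_superset[of L "set bs"] submodule_carrier[OF add_mult_submodule]
  by (auto simp: regular_mod_def)

section \<open>Interchanging nonzerodivisors\<close>

lemma smult_minus_smult: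
  assumes "c \<in> carrier R" "d \<in> carrier R" "m \<in> carrier M" "n \<in> carrier M" "k \<in> carrier M"
  shows "c \<odot>\<^bsub>M\<^esub> (m \<ominus>\<^bsub>M\<^esub> d \<odot>\<^bsub>M\<^esub> k)
    = (c \<odot>\<^bsub>M\<^esub> m \<ominus>\<^bsub>M\<^esub> d \<odot>\<^bsub>M\<^esub> n) \<oplus>\<^bsub>M\<^esub> d \<odot>\<^bsub>M\<^esub> (n \<ominus>\<^bsub>M\<^esub> c \<odot>\<^bsub>M\<^esub> k)"
proof -
  have *: "a \<ominus>\<^bsub>M\<^esub> e = (a \<ominus>\<^bsub>M\<^esub> b) \<oplus>\<^bsub>M\<^esub> (b \<ominus>\<^bsub>M\<^esub> e)"
    if "a \<in> carrier M" "b \<in> carrier M" "e \<in> carrier M" for a b e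
    using that by (simp add: a_minus_def M.a_assoc M.r_neg1 M.r_neg2)
  show ?thesis
    using *[of "c \<odot>\<^bsub>M\<^esub> m" "d \<odot>\<^bsub>M\<^esub> n" "c \<odot>\<^bsub>M\<^esub> (d \<odot>\<^bsub>M\<^esub> k)"] assms
    by (simp add: smult_minus smult_commute[of d c])
qed

text \<open>Modulo \<open>L\<close>: if \<open>b n = y m\<close>, then \<open>m\<close> vanishes
  modulo \<open>b\<close> because \<open>y\<close> is regular there, say \<open>m = b k\<close>.
  Cancelling \<open>b\<close> in \<open>b n = b y k\<close> gives \<open>n = y k\<close>.\<close>

lemma nzd_mod_swap:
  assumes L: "submodule L R M" and b: "nzd_mod R M L b" and y: "nzd_mod R M (add_mult R M L {b}) y"
  shows "nzd_mod R M (add_mult R M L {y}) b"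
  unfolding nzd_mod_def
proof (intro conjI ballI impI)
  show bR: "b \<in> carrier R" using b by (simp add: nzd_mod_def)
  have yR: "y \<in> carrier R" using y by (simp add: nzd_mod_def)
  fix n assume n: "n \<in> carrier M" and bn: "b \<odot>\<^bsub>M\<^esub> n \<in> add_mult R M L {y}"
  then obtain m where m: "m \<in> carrier M" "b \<odot>\<^bsub>M\<^esub> n \<ominus>\<^bsub>M\<^esub> y \<odot>\<^bsub>M\<^esub> m \<in> L"
    using add_mult_singleE[OF L yR bn] by blast
  have Lb: "submodule (add_mult R M L {b}) R M"
    using add_mult_submodule L bR by simp
  have "b \<odot>\<^bsub>M\<^esub> n \<ominus>\<^bsub>M\<^esub> y \<odot>\<^bsub>M\<^esub> m \<in> add_mult R M L {b}" "b \<odot>\<^bsub>M\<^esub> n \<in> add_mult R M L {b}"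
    using m(2) add_mult_superset[of L "{b}"] smult_in_add_mult[of b "{b}" n] n by auto
  then have "y \<odot>\<^bsub>M\<^esub> m \<in> add_mult R M L {b}"
    using submodule_add_iff[OF Lb, of "b \<odot>\<^bsub>M\<^esub> n" "\<ominus>\<^bsub>M\<^esub> (y \<odot>\<^bsub>M\<^esub> m)"] m yR
      submodule_uminus[OF Lb, of "\<ominus>\<^bsub>M\<^esub> (y \<odot>\<^bsub>M\<^esub> m)"] by (simp add: a_minus_def)
  then have "m \<in> add_mult R M L {b}"
    using nzd_modD[OF y m(1)] by blast
  then obtain k where k: "k \<in> carrier M" "m \<ominus>\<^bsub>M\<^esub> b \<odot>\<^bsub>M\<^esub> k \<in> L"
    using add_mult_singleE[OF L bR] by blast
  \<comment> \<open>The element is \<open>(b n - y m) + y (m - b k)\<close>, and both summands lie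
    in \<open>L\<close>.\<close>
  have "b \<odot>\<^bsub>M\<^esub> (n \<ominus>\<^bsub>M\<^esub> y \<odot>\<^bsub>M\<^esub> k) \<in> L"
    using smult_minus_smult[OF bR yR n m(1) k(1)] submodule_add[OF L m(2) submodule_smult[OF L yR k(2)]]
    by simp
  then have "n \<ominus>\<^bsub>M\<^esub> y \<odot>\<^bsub>M\<^esub> k \<in> L"
    using nzd_modD[OF b] n k(1) yR by simp
  then show "n \<in> add_mult R M L {y}"
    using add_mult_singleI[OF L yR k(1) n] by blast
qed

lemma minus_minus_cancel:
  assumes "p \<in> carrier M" "q \<in> carrier M" "r \<in> carrier M"
  shows "(p \<ominus>\<^bsub>M\<^esub> q) \<ominus>\<^bsub>M\<^esub> (p \<ominus>\<^bsub>M\<^esub> r) = r \<ominus>\<^bsub>M\<^esub> q"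
proof -
  have "(p \<ominus>\<^bsub>M\<^esub> q) \<ominus>\<^bsub>M\<^esub> (p \<ominus>\<^bsub>M\<^esub> r) = p \<oplus>\<^bsub>M\<^esub> (\<ominus>\<^bsub>M\<^esub> p \<oplus>\<^bsub>M\<^esub> (r \<ominus>\<^bsub>M\<^esub> q))"
    using assms by (simp add: a_minus_def M.minus_add M.a_ac)
  then show ?thesis
    using assms by (simp add: M.r_neg2)
qed

text \<open>An elementary substitute for the isomorphisms of \<open>Hom(R/I, M/bM)\<close> and
  \<open>Hom(R/I, M/xM)\<close> with \<open>Ext^1(R/I, M)\<close>, with \<open>M/L\<close> in place
  of \<open>M\<close>. If \<open>I\<close> kills \<open>u\<close> modulo \<open>x\<close>, write
  \<open>b u = x v\<close>; then \<open>I\<close> kills \<open>v\<close> modulo \<open>b\<close>, so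
  \<open>v = b k\<close> by \<open>free\<close>, and cancelling \<open>b\<close> gives
  \<open>u = x k\<close>.\<close>

lemma socle_free_swap:
  assumes L: "submodule L R M" and b: "nzd_mod R M L b" and x: "nzd_mod R M L x"
    and I: "b \<in> I" "x \<in> I" "I \<subseteq> carrier R"
    and free: "\<And>n. n \<in> carrier M \<Longrightarrow> (\<And>c. c \<in> I \<Longrightarrow> c \<odot>\<^bsub>M\<^esub> n \<in> add_mult R M L {b}) \<Longrightarrow> n \<in> add_mult R M L {b}"
    and u: "u \<in> carrier M" "\<And>c. c \<in> I \<Longrightarrow> c \<odot>\<^bsub>M\<^esub> u \<in> add_mult R M L {x}"
  shows "u \<in> add_mult R M L {x}"
proof -
  have bR: "b \<in> carrier R" and xR: "x \<in> carrier R"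
    using I by auto
  obtain v where v: "v \<in> carrier M" "b \<odot>\<^bsub>M\<^esub> u \<ominus>\<^bsub>M\<^esub> x \<odot>\<^bsub>M\<^esub> v \<in> L"
    using add_mult_singleE[OF L xR u(2)[OF I(1)]] by blast
  have "c \<odot>\<^bsub>M\<^esub> v \<in> add_mult R M L {b}" if c: "c \<in> I" for c
  proof -
    have cR: "c \<in> carrier R" using c I by blast
    obtain w where w: "w \<in> carrier M" "c \<odot>\<^bsub>M\<^esub> u \<ominus>\<^bsub>M\<^esub> x \<odot>\<^bsub>M\<^esub> w \<in> L"
      using add_mult_singleE[OF L xR u(2)[OF c]] by blast
    \<comment> \<open>The terms \<open>b c u\<close> cancel and leave a multiple of
      \<open>x\<close>, which is cancelled because \<open>x\<close> is regular modulo
      \<open>L\<close>.\<close>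
    have "b \<odot>\<^bsub>M\<^esub> (c \<odot>\<^bsub>M\<^esub> u \<ominus>\<^bsub>M\<^esub> x \<odot>\<^bsub>M\<^esub> w) \<ominus>\<^bsub>M\<^esub> c \<odot>\<^bsub>M\<^esub> (b \<odot>\<^bsub>M\<^esub> u \<ominus>\<^bsub>M\<^esub> x \<odot>\<^bsub>M\<^esub> v) \<in> L"
      by (intro submodule_minus[OF L] submodule_smult[OF L] bR cR v w)
    also have "b \<odot>\<^bsub>M\<^esub> (c \<odot>\<^bsub>M\<^esub> u \<ominus>\<^bsub>M\<^esub> x \<odot>\<^bsub>M\<^esub> w) \<ominus>\<^bsub>M\<^esub> c \<odot>\<^bsub>M\<^esub> (b \<odot>\<^bsub>M\<^esub> u \<ominus>\<^bsub>M\<^esub> x \<odot>\<^bsub>M\<^esub> v)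
        = x \<odot>\<^bsub>M\<^esub> (c \<odot>\<^bsub>M\<^esub> v \<ominus>\<^bsub>M\<^esub> b \<odot>\<^bsub>M\<^esub> w)"
      using bR cR xR u(1) v(1) w(1)
      by (simp add: smult_minus smult_commute[of b c] smult_commute[of x b] smult_commute[of x c] minus_minus_cancel)
    finally have "c \<odot>\<^bsub>M\<^esub> v \<ominus>\<^bsub>M\<^esub> b \<odot>\<^bsub>M\<^esub> w \<in> L"
      using nzd_modD[OF x] bR cR v(1) w(1) by simp
    then show ?thesis
      using add_mult_singleI[OF L bR w(1)] cR v(1) by simp
  qed
  then have "v \<in> add_mult R M L {b}"
    using free v(1) by blast
  then obtain k where k: "k \<in> carrier M" "v \<ominus>\<^bsub>M\<^esub> b \<odot>\<^bsub>M\<^esub> k \<in> L"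
    using add_mult_singleE[OF L bR] by blast
  have "b \<odot>\<^bsub>M\<^esub> (u \<ominus>\<^bsub>M\<^esub> x \<odot>\<^bsub>M\<^esub> k) \<in> L"
    using smult_minus_smult[OF bR xR u(1) v(1) k(1)] submodule_add[OF L v(2) submodule_smult[OF L xR k(2)]]
    by simp
  then have "u \<ominus>\<^bsub>M\<^esub> x \<odot>\<^bsub>M\<^esub> k \<in> L"
    using nzd_modD[OF b] u k(1) xR by simp
  then show ?thesis
    using add_mult_singleI[OF L xR k(1) u(1)] by blast
qed

section \<open>Associated primes\<close>

lemma exists_prime_colon:
  assumes noeth: "noetherian_ring R" and L: "submodule L R M" and n: "n \<in> carrier M" "n \<notin> L"
  obtains P where "P \<in> assoc_mod R M L" "colon R M L n \<subseteq> P"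
proof -
  define Q where "Q = {colon R M L (c \<odot>\<^bsub>M\<^esub> n) | c. c \<in> carrier R \<and> c \<odot>\<^bsub>M\<^esub> n \<notin> L}"
  have "colon R M L (\<one> \<odot>\<^bsub>M\<^esub> n) \<in> Q"
    unfolding Q_def using n by (intro CollectI exI[of _ \<one>]) simp
  then obtain P where P: "P \<in> Q" and max: "\<And>J. (J, P) \<in> {(J, I). ideal I R \<and> ideal J R \<and> I \<subset> J} \<Longrightarrow> J \<notin> Q"
    by (rule wfE_min[OF noetherian_ring.wf_ideals[OF noeth]]) (rule that)
  from P obtain c where c: "c \<in> carrier R" "c \<odot>\<^bsub>M\<^esub> n \<notin> L" and P_eq: "P = colon R M L (c \<odot>\<^bsub>M\<^esub> n)"
    by (auto simp: Q_def)
  have cn: "c \<odot>\<^bsub>M\<^esub> n \<in> carrier M"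
    using c n by simp
  have "primeideal P R"
  proof (rule primeidealI)
    show iP: "ideal P R"
      unfolding P_eq by (rule ideal_colon[OF L cn])
    show "carrier R \<noteq> P"
      using one_in_colon_iff[OF cn] c(2) by (auto simp: P_eq)
    fix a b assume ab: "a \<in> carrier R" "b \<in> carrier R" "a \<otimes> b \<in> P"
    have bc: "b \<odot>\<^bsub>M\<^esub> (c \<odot>\<^bsub>M\<^esub> n) = (b \<otimes> c) \<odot>\<^bsub>M\<^esub> n"
      using ab c n by (simp add: smult_assoc1)
    show "a \<in> P \<or> b \<in> P"
    proof (rule disjCI)
      assume "b \<notin> P"
      then have "b \<odot>\<^bsub>M\<^esub> (c \<odot>\<^bsub>M\<^esub> n) \<notin> L"
        using ab by (simp add: P_eq colon_def)
      \<comment> \<open>This ideal belongs to the family and contains \<open>P\<close>, so by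
        maximality it equals \<open>P\<close>; and \<open>a\<close> lies in it since
        \<open>a \<otimes> b \<in> P\<close>.\<close>
      then have "colon R M L (b \<odot>\<^bsub>M\<^esub> (c \<odot>\<^bsub>M\<^esub> n)) \<in> Q"
        unfolding Q_def bc using ab c by (intro CollectI exI[of _ "b \<otimes> c"]) simp
      moreover have "P \<subseteq> colon R M L (b \<odot>\<^bsub>M\<^esub> (c \<odot>\<^bsub>M\<^esub> n))"
        unfolding P_eq by (rule colon_smult_superset[OF L cn ab(2)])
      moreover have "ideal (colon R M L (b \<odot>\<^bsub>M\<^esub> (c \<odot>\<^bsub>M\<^esub> n))) R"
        using ideal_colon[OF L] ab cn by simp
      ultimately have "P = colon R M L (b \<odot>\<^bsub>M\<^esub> (c \<odot>\<^bsub>M\<^esub> n))"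
        using max iP by blast
      moreover have "a \<in> colon R M L (b \<odot>\<^bsub>M\<^esub> (c \<odot>\<^bsub>M\<^esub> n))"
        using ab cn by (simp add: P_eq colon_def smult_assoc1)
      ultimately show "a \<in> P" by simp
    qed
  qed (rule R.is_cring)
  moreover have "colon R M L n \<subseteq> P"
    unfolding P_eq by (rule colon_smult_superset[OF L n(1) c(1)])
  ultimately show thesis
    using that cn P_eq by (auto simp: assoc_mod_def)
qed

text \<open>The class of \<open>m\<close> generates a copy of the domain \<open>R / P\<close>, where
  \<open>P\<close> is its annihilator, and all nonzero elements of that copy have annihilator
  \<open>P\<close>.\<close>

lemma colon_smult_prime:
  assumes L: "submodule L R M" and m: "m \<in> carrier M" and P: "primeideal (colon R M L m) R"
    and c: "c \<in> carrier R" "c \<odot>\<^bsub>M\<^esub> m \<notin> L"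
  shows "colon R M L (c \<odot>\<^bsub>M\<^esub> m) = colon R M L m"
proof
  show "colon R M L (c \<odot>\<^bsub>M\<^esub> m) \<subseteq> colon R M L m"
  proof
    fix a assume a: "a \<in> colon R M L (c \<odot>\<^bsub>M\<^esub> m)"
    then have "a \<in> carrier R" "a \<otimes> c \<in> colon R M L m"
      using c m by (auto simp: colon_def smult_assoc1)
    then have "a \<in> colon R M L m \<or> c \<in> colon R M L m"
      using primeideal.I_prime[OF P] c by blast
    then show "a \<in> colon R M L m"
      using c by (simp add: colon_def)
  qed
qed (rule colon_smult_superset[OF L m c(1)])

text \<open>If the colon ideal \<open>Q\<close> of \<open>m\<close> does not grow on passing to the
  larger submodule, \<open>Q\<close> is associated to the latter. Otherwise some \<open>c m\<close>
  outside \<open>L\<close> is congruent to a multiple \<open>d n\<close> modulo \<open>L\<close>,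
  and by \<open>colon_smult_prime\<close> its colon ideal is both \<open>Q\<close> and that of
  \<open>n\<close>.\<close>

lemma assoc_mod_cyclic_extension:
  assumes L: "submodule L R M" and n: "n \<in> carrier M" and P: "primeideal (colon R M L n) R"
  shows "assoc_mod R M L \<subseteq>
    insert (colon R M L n) (assoc_mod R M (L <+>\<^bsub>M\<^esub> (\<lambda>c. c \<odot>\<^bsub>M\<^esub> n) ` carrier R))"
proof
  define L' where "L' = L <+>\<^bsub>M\<^esub> (\<lambda>c. c \<odot>\<^bsub>M\<^esub> n) ` carrier R"
  fix Q assume "Q \<in> assoc_mod R M L"
  then obtain m where Q: "primeideal Q R" and m: "m \<in> carrier M" "Q = colon R M L m"
    by (auto simp: assoc_mod_def)
  have "L \<subseteq> L'"
    unfolding L'_def using set_add_upper[OF L submodule_cyclic[OF n]] by blast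
  then have sub: "Q \<subseteq> colon R M L' m"
    by (auto simp: m(2) colon_def)
  show "Q \<in> insert (colon R M L n) (assoc_mod R M L')"
  proof (cases "colon R M L' m \<subseteq> Q")
    case True
    then show ?thesis
      using sub Q m(1) by (auto simp: assoc_mod_def)
  next
    case False
    then obtain c where c: "c \<in> carrier R" "c \<odot>\<^bsub>M\<^esub> m \<in> L'" "c \<odot>\<^bsub>M\<^esub> m \<notin> L"
      by (auto simp: colon_def m(2))
    then obtain l d where l: "l \<in> L" and d: "d \<in> carrier R" and cm: "c \<odot>\<^bsub>M\<^esub> m = l \<oplus>\<^bsub>M\<^esub> d \<odot>\<^bsub>M\<^esub> n"
      by (auto simp: L'_def set_add_def')
    have "d \<odot>\<^bsub>M\<^esub> n \<notin> L"
      using submodule_add[OF L l] c(3) cm by metis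
    have "a \<odot>\<^bsub>M\<^esub> (c \<odot>\<^bsub>M\<^esub> m) \<in> L \<longleftrightarrow> a \<odot>\<^bsub>M\<^esub> (d \<odot>\<^bsub>M\<^esub> n) \<in> L" if "a \<in> carrier R" for a
      unfolding cm
      using submodule_add_iff[OF L submodule_smult[OF L that l]] that d n submodule_carrier[OF L l]
      by (simp add: smult_r_distr)
    then have "colon R M L (c \<odot>\<^bsub>M\<^esub> m) = colon R M L (d \<odot>\<^bsub>M\<^esub> n)"
      by (auto simp: colon_def)
    then show ?thesis
      using colon_smult_prime[OF L m(1) _ c(1,3)] Q colon_smult_prime[OF L n P d \<open>d \<odot>\<^bsub>M\<^esub> n \<notin> L\<close>] m(2)
      by simp
  qed
qed

end

section \<open>Prime avoidance\<close>

lemma (in cring) exists_in_ideals_notin_prime: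
  assumes P: "primeideal P R" and F: "finite F" "\<And>I. I \<in> F \<Longrightarrow> ideal I R" "\<And>I. I \<in> F \<Longrightarrow> \<not> I \<subseteq> P"
  shows "\<exists>z\<in>carrier R. z \<notin> P \<and> (\<forall>I\<in>F. z \<in> I)"
  using F
proof (induction F)
  case empty
  then show ?case
    using primeideal.I_notcarr[OF P] ideal.Icarr[OF primeideal.axioms(1)[OF P]] by blast
next
  case (insert I F)
  then obtain z where z: "z \<in> carrier R" "z \<notin> P" "\<forall>I\<in>F. z \<in> I"
    by auto
  from insert.prems obtain i where i: "i \<in> I" "i \<notin> P" and I: "ideal I R"
    by auto
  have iR: "i \<in> carrier R"
    using ideal.Icarr[OF I i(1)] .
  \<comment> \<open>The witness is built as a product with one factor outside \<open>P\<close> from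
    each ideal.\<close>
  have "z \<otimes> i \<notin> P"
    using primeideal.I_prime[OF P z(1) iR] z i by blast
  moreover have "z \<otimes> i \<in> J" if "J \<in> insert I F" for J
    using that insert.prems(1) z i iR ideal.I_l_closed[OF I] ideal.I_r_closed[of J R z i] by auto
  ultimately show ?case
    using z iR by (intro bexI[of _ "z \<otimes> i"]) auto
qed

lemma (in cring) prime_avoidance:
  assumes I: "ideal I R" and F: "finite F" "\<And>P. P \<in> F \<Longrightarrow> primeideal P R" "\<And>P. P \<in> F \<Longrightarrow> \<not> I \<subseteq> P"
  shows "\<exists>y\<in>I. \<forall>P\<in>F. y \<notin> P"
  using F
proof (induction F rule: finite_psubset_induct)
  case (psubset F)
  show ?case
  proof (cases "F = {}")
    case True
    then show ?thesis
      using additive_subgroup.zero_closed[OF ideal.axioms(1)[OF I]] by blast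
  next
    case False
    then obtain P where P: "P \<in> F" by blast
    \<comment> \<open>The primes inside \<open>P\<close>, including \<open>P\<close> itself, are
      dropped: avoiding \<open>P\<close> avoids them too. No remaining prime lies in
      \<open>P\<close>, which is what the choice of \<open>z\<close> below needs.\<close>
    define G where "G = {Q \<in> F. \<not> Q \<subseteq> P}"
    have "G \<subset> F"
      using P by (auto simp: G_def)
    have "\<exists>y\<in>I. \<forall>Q\<in>G. y \<notin> Q"
      by (rule psubset.IH[OF \<open>G \<subset> F\<close>]) (auto simp: G_def psubset.prems)
    then obtain y where y: "y \<in> I" "\<forall>Q\<in>G. y \<notin> Q"
      by blast
    show ?thesis
    proof (cases "y \<in> P")
      case False
      then show ?thesis
        using y by (intro bexI[of _ y]) (auto simp: G_def)
    next
      case True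
      have "finite (insert I G)"
        using \<open>G \<subset> F\<close> psubset.hyps finite_subset[of G F] by auto
      then have "\<exists>z\<in>carrier R. z \<notin> P \<and> (\<forall>J\<in>insert I G. z \<in> J)"
      proof (rule exists_in_ideals_notin_prime[OF psubset.prems(1)[OF P]])
        show "ideal J R" if "J \<in> insert I G" for J
          using that I primeideal.axioms(1)[OF psubset.prems(1)] \<open>G \<subset> F\<close> by blast
        show "\<not> J \<subseteq> P" if "J \<in> insert I G" for J
          using that psubset.prems(2)[OF P] by (auto simp: G_def)
      qed
      then obtain z where z: "z \<in> carrier R" "z \<notin> P" "\<forall>J\<in>insert I G. z \<in> J"
        by blast
      have yR: "y \<in> carrier R"
        using ideal.Icarr[OF I y(1)] .
      \<comment> \<open>Exactly one of \<open>y\<close> and \<open>z\<close> lies in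
        \<open>P\<close>, and exactly one in each member of \<open>G\<close>, so the sum avoids them
        all, while both lie in \<open>I\<close>.\<close>
      have add: "y \<oplus> z \<in> J \<longleftrightarrow> (y \<in> J \<longleftrightarrow> z \<in> J)" if J: "ideal J R" "y \<in> J \<or> z \<in> J" for J
      proof -
        interpret J: ideal J R by fact
        have "y \<in> J" if "y \<oplus> z \<in> J" "z \<in> J"
          using J.a_closed[OF that(1) J.a_inv_closed[OF that(2)]] yR z(1) by (simp add: a_assoc r_neg)
        moreover have "z \<in> J" if "y \<oplus> z \<in> J" "y \<in> J"
          using J.a_closed[OF J.a_inv_closed[OF that(2)] that(1)] yR z(1) by (simp add: r_neg1)
        ultimately show ?thesis
          using J(2) J.a_closed by blast
      qed
      have "y \<oplus> z \<notin> P"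
        using add[OF primeideal.axioms(1)] psubset.prems(1)[OF P] True z(2) by blast
      moreover have "y \<oplus> z \<notin> Q" if "Q \<in> G" for Q
        using add[OF primeideal.axioms(1), of Q] psubset.prems(1)[of Q] that y z \<open>G \<subset> F\<close> by blast
      moreover have "y \<oplus> z \<in> I"
        using add[OF I] y(1) z(3) by blast
      ultimately show ?thesis
        by (intro bexI[of _ "y \<oplus> z"]) (auto simp: G_def)
    qed
  qed
qed

section \<open>Noetherian local rings\<close>

locale noetherian_local_module = module +
  fixes \<mm> :: "'a set"
  assumes noetherian: "noetherian_ring R" and local: "local_ring R \<mm>"
    and fin_gen: "fin_gen_module R M"
begin

lemma maximal_ideal: "ideal \<mm> R" "\<one> \<notin> \<mm>" "\<mm> \<subseteq> carrier R"
proof -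
  interpret m: maximalideal \<mm> R
    using local by (simp add: local_ring_def)
  show "ideal \<mm> R" by (rule m.is_ideal)
  show "\<one> \<notin> \<mm>" using m.one_imp_carrier m.I_notcarr by blast
  show "\<mm> \<subseteq> carrier R" by (rule m.a_subset)
qed

text \<open>The ascending chain condition supplies a maximal ideal above \<open>I\<close>, and it
  can only be \<open>\<mm>\<close>.\<close>

lemma proper_ideal_subset:
  assumes I: "ideal I R" "\<one> \<notin> I"
  shows "I \<subseteq> \<mm>"
proof -
  define Q where "Q = {J. ideal J R \<and> I \<subseteq> J \<and> \<one> \<notin> J}"
  have "I \<in> Q"
    using I by (simp add: Q_def)
  then obtain J where J: "J \<in> Q" and max: "\<And>K. (K, J) \<in> {(J, I). ideal I R \<and> ideal J R \<and> I \<subset> J} \<Longrightarrow> K \<notin> Q"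
    by (rule wfE_min[OF noetherian_ring.wf_ideals[OF noetherian]]) (rule that)
  have "maximalideal J R"
  proof (rule maximalidealI)
    show "ideal J R" "carrier R \<noteq> J"
      using J by (auto simp: Q_def)
    fix K assume K: "ideal K R" "J \<subseteq> K" "K \<subseteq> carrier R"
    show "K = J \<or> K = carrier R"
    proof (cases "\<one> \<in> K")
      case True
      then show ?thesis
        using ideal.one_imp_carrier[OF K(1)] by simp
    next
      case False
      then have "K \<in> Q"
        using J K by (auto simp: Q_def)
      then show ?thesis
        using max[of K] J K by (auto simp: Q_def)
    qed
  qed
  then have "J = \<mm>"
    using local by (simp add: local_ring_def)
  then show ?thesis
    using J by (simp add: Q_def)
qed

text \<open>\<open>U\<close> may be any subset. Take \<open>u\<close> in \<open>U\<close> outside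
  \<open>L\<close> with \<open>L + R u\<close> maximal, and write \<open>u = x v\<close> modulo
  \<open>L\<close>. Then \<open>L + R u\<close> is contained in \<open>L + R v\<close>, hence equal
  to it, so \<open>v = c u\<close> modulo \<open>L\<close> and \<open>1 - x c\<close> carries
  \<open>u\<close> into \<open>L\<close>. Since \<open>u\<close> is not in \<open>L\<close>, this
  puts \<open>1 - x c\<close>, and with it 1, into \<open>\<mm>\<close>.\<close>

lemma nakayama:
  assumes L: "submodule L R M" and U: "U \<subseteq> carrier M" and x: "x \<in> \<mm>"
    and step: "\<And>u. u \<in> U \<Longrightarrow> \<exists>v\<in>U. u \<ominus>\<^bsub>M\<^esub> x \<odot>\<^bsub>M\<^esub> v \<in> L"
  shows "U \<subseteq> L"
proof (rule ccontr)
  assume "\<not> U \<subseteq> L"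
  then obtain u0 where u0: "u0 \<in> U - L" by blast
  have xR: "x \<in> carrier R"
    using x maximal_ideal by blast
  define C where "C u = L <+>\<^bsub>M\<^esub> (\<lambda>c. c \<odot>\<^bsub>M\<^esub> u) ` carrier R" for u
  have C: "submodule (C u) R M" if "u \<in> U" for u
    unfolding C_def using that U by (intro submodule_set_add L submodule_cyclic) blast
  have self: "u \<in> C u" if "u \<in> U" for u
    unfolding C_def using set_add_upper(2)[OF L submodule_cyclic] cyclic_self that U by blast
  have LC: "L \<subseteq> C u" if "u \<in> U" for u
    unfolding C_def using set_add_upper(1)[OF L submodule_cyclic] that U by blast
  have "C u0 \<in> C ` (U - L)"
    using u0 by blast
  then obtain K where "K \<in> C ` (U - L)"
    and max: "\<And>K'. (K', K) \<in> {(L', L). submodule L R M \<and> submodule L' R M \<and> L \<subset> L'} \<Longrightarrow> K' \<notin> C ` (U - L)"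
    by (rule wfE_min[OF wf_submodules[OF noetherian fin_gen]]) (rule that)
  then obtain u where u: "u \<in> U" "u \<notin> L" and K: "K = C u"
    by blast
  obtain v where v: "v \<in> U" "u \<ominus>\<^bsub>M\<^esub> x \<odot>\<^bsub>M\<^esub> v \<in> L"
    using step u by blast
  have uM: "u \<in> carrier M" and vM: "v \<in> carrier M"
    using u v U by auto
  have "v \<notin> L"
    using submodule_minus_iff[OF L _ uM v(2)] submodule_smult[OF L xR] u(2) xR vM by auto
  have "u \<in> C v"
    using submodule_minus_iff[OF C[OF v(1)] _ uM, of "x \<odot>\<^bsub>M\<^esub> v"] LC v
      submodule_smult[OF C[OF v(1)] xR self[OF v(1)]] xR vM by blast
  then have "C u \<subseteq> C v"
    unfolding C_def[of u] using LC[OF v(1)] submodule_smult[OF C[OF v(1)]]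
    by (intro set_add_least C v) auto
  moreover have "\<not> C u \<subset> C v"
    using max[of "C v"] C u v \<open>v \<notin> L\<close> by (auto simp: K)
  ultimately have "v \<in> C u"
    using self[OF v(1)] by blast
  then obtain l c where l: "l \<in> L" and c: "c \<in> carrier R" and vl: "v = l \<oplus>\<^bsub>M\<^esub> c \<odot>\<^bsub>M\<^esub> u"
    by (auto simp: C_def set_add_def')
  have lM: "l \<in> carrier M"
    using submodule_carrier[OF L l] .
  have "(\<one> \<ominus> x \<otimes> c) \<odot>\<^bsub>M\<^esub> u = (u \<ominus>\<^bsub>M\<^esub> x \<odot>\<^bsub>M\<^esub> v) \<oplus>\<^bsub>M\<^esub> x \<odot>\<^bsub>M\<^esub> l"
    using xR c uM lM
    by (simp add: vl R.minus_eq M.minus_eq smult_l_distr smult_l_minus smult_assoc1 smult_r_distr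
      M.minus_add M.a_assoc M.l_neg M.a_comm[of "x \<odot>\<^bsub>M\<^esub> l"])
  then have "\<one> \<ominus> x \<otimes> c \<in> colon R M L u"
    using submodule_add[OF L v(2) submodule_smult[OF L xR l]] xR c by (simp add: colon_def)
  moreover have "colon R M L u \<subseteq> \<mm>"
    using ideal_colon[OF L uM] one_in_colon_iff[OF uM] u(2) by (intro proper_ideal_subset) auto
  ultimately have d: "\<one> \<ominus> x \<otimes> c \<in> \<mm>"
    by blast
  interpret m: ideal \<mm> R
    by (rule maximal_ideal)
  have "(\<one> \<ominus> x \<otimes> c) \<oplus> x \<otimes> c \<in> \<mm>"
    using d x c by (intro m.a_closed m.I_r_closed)
  then show False
    using maximal_ideal(2) xR c by (simp add: R.minus_eq R.a_assoc R.l_neg)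
qed

lemma add_mult_neq_carrier:
  assumes L: "submodule L R M" and x: "x \<in> \<mm>" and neq: "L \<noteq> carrier M"
  shows "add_mult R M L {x} \<noteq> carrier M"
proof
  assume eq: "add_mult R M L {x} = carrier M"
  have xR: "x \<in> carrier R"
    using x maximal_ideal by blast
  have "carrier M \<subseteq> L"
  proof (rule nakayama[OF L _ x])
    fix u assume "u \<in> carrier M"
    then show "\<exists>v\<in>carrier M. u \<ominus>\<^bsub>M\<^esub> x \<odot>\<^bsub>M\<^esub> v \<in> L"
      using add_mult_singleE[OF L xR, of u] eq by blast
  qed simp
  then show False
    using neq submodule_carrier[OF L] by blast
qed

lemma finite_assoc_mod:
  assumes "submodule L R M"
  shows "finite (assoc_mod R M L)"
  using wf_submodules[OF noetherian fin_gen] assms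
proof (induction L rule: wf_induct_rule)
  case (less L)
  show ?case
  proof (cases "assoc_mod R M L = {}")
    case False
    then obtain n where n: "n \<in> carrier M" and P: "primeideal (colon R M L n) R"
      by (auto simp: assoc_mod_def)
    \<comment> \<open>Enlarging \<open>L\<close> by \<open>n\<close> loses at most the associated
      prime of \<open>n\<close>, so induction over growing submodules yields finiteness.\<close>
    define L' where "L' = L <+>\<^bsub>M\<^esub> (\<lambda>c. c \<odot>\<^bsub>M\<^esub> n) ` carrier R"
    have L': "submodule L' R M"
      unfolding L'_def by (intro submodule_set_add less.prems submodule_cyclic n)
    have "n \<notin> L"
      using primeideal.I_notcarr[OF P] ideal.one_imp_carrier[OF primeideal.axioms(1)[OF P]]
        one_in_colon_iff[OF n] by blast
    then have "L \<subset> L'"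
      using set_add_upper[OF less.prems submodule_cyclic[OF n]] cyclic_self[OF n]
      unfolding L'_def by blast
    then have "finite (assoc_mod R M L')"
      using less.IH less.prems L' by blast
    then show ?thesis
      using assoc_mod_cyclic_extension[OF less.prems n P] finite_subset unfolding L'_def by blast
  qed simp
qed

text \<open>If \<open>\<mm>\<close> were contained in an associated prime, that prime would be the
  colon ideal of an element killed by \<open>\<mm>\<close>, which \<open>free\<close> makes zero.
  Prime avoidance then gives a \<open>y\<close> outside all the finitely many associated primes, and
  these contain all zero divisors.\<close>

lemma exists_common_nzd:
  assumes fin: "finite \<L>" and sub: "\<And>L. L \<in> \<L> \<Longrightarrow> submodule L R M"
    and free: "\<And>L n. L \<in> \<L> \<Longrightarrow> n \<in> carrier M \<Longrightarrow> (\<And>c. c \<in> \<mm> \<Longrightarrow> c \<odot>\<^bsub>M\<^esub> n \<in> L) \<Longrightarrow> n \<in> L"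
  obtains y where "y \<in> \<mm>" "\<And>L. L \<in> \<L> \<Longrightarrow> nzd_mod R M L y"
proof -
  have "\<exists>y\<in>\<mm>. \<forall>P\<in>(\<Union>L\<in>\<L>. assoc_mod R M L). y \<notin> P"
  proof (rule R.prime_avoidance)
    show "ideal \<mm> R" by (rule maximal_ideal)
    show "finite (\<Union>L\<in>\<L>. assoc_mod R M L)"
      using fin sub finite_assoc_mod by blast
    show "primeideal P R" if "P \<in> (\<Union>L\<in>\<L>. assoc_mod R M L)" for P
      using that by (auto simp: assoc_mod_def)
    show "\<not> \<mm> \<subseteq> P" if P: "P \<in> (\<Union>L\<in>\<L>. assoc_mod R M L)" for P
    proof
      assume mP: "\<mm> \<subseteq> P"
      from P obtain L n where Ln: "L \<in> \<L>" "n \<in> carrier M" "P = colon R M L n" and prime: "primeideal P R"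
        by (auto simp: assoc_mod_def)
      have "n \<in> L"
        using free[OF Ln(1,2)] mP Ln(3) by (auto simp: colon_def)
      then have "\<one> \<in> P"
        using one_in_colon_iff Ln by blast
      then show False
        using primeideal.I_notcarr[OF prime] ideal.one_imp_carrier[OF primeideal.axioms(1)[OF prime]] by blast
    qed
  qed
  then obtain y where y: "y \<in> \<mm>" "\<And>L P. L \<in> \<L> \<Longrightarrow> P \<in> assoc_mod R M L \<Longrightarrow> y \<notin> P"
    by blast
  have yR: "y \<in> carrier R"
    using y maximal_ideal by blast
  have "nzd_mod R M L y" if L: "L \<in> \<L>" for L
    unfolding nzd_mod_def
  proof (intro conjI ballI impI yR)
    fix n assume n: "n \<in> carrier M" "y \<odot>\<^bsub>M\<^esub> n \<in> L"
    show "n \<in> L"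
    proof (rule ccontr)
      assume "n \<notin> L"
      then obtain P where "P \<in> assoc_mod R M L" "colon R M L n \<subseteq> P"
        using exists_prime_colon[OF noetherian sub[OF L] n(1)] by blast
      then show False
        using y(2)[OF L] n yR by (auto simp: colon_def)
    qed
  qed
  then show thesis
    using that y by blast
qed

lemma regular_mod_exchange:
  assumes "submodule L R M" "set bs \<subseteq> \<mm>" "regular_mod R M L bs" "bs \<noteq> []"
    and "x \<in> \<mm>" "nzd_mod R M L x"
  shows "\<exists>cs. set cs \<subseteq> \<mm> \<and> regular_mod R M (add_mult R M L {x}) cs \<and> Suc (length cs) = length bs"
  using assms
proof (induction "length bs" arbitrary: L bs x rule: less_induct)
  case less
  note L = less.prems(1) and x = less.prems(5) and nzd_x = less.prems(6)
  have mR: "y \<in> carrier R" if "y \<in> \<mm>" for y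
    using that maximal_ideal by blast
  have sub: "submodule (add_mult R M K {y}) R M" if "submodule K R M" "y \<in> \<mm>" for K y
    using add_mult_submodule that mR by simp
  have comm: "add_mult R M (add_mult R M L {y}) {z} = add_mult R M (add_mult R M L {z}) {y}"
    if "y \<in> \<mm>" "z \<in> \<mm>" for y z
    using add_mult_Un[OF L] that mR by (simp add: insert_commute)
  have regular_Cons: "regular_mod R M K (y # ys) \<longleftrightarrow> nzd_mod R M K y \<and> regular_mod R M (add_mult R M K {y}) ys"
    if "submodule K R M" "y \<in> \<mm>" "set ys \<subseteq> \<mm>" for K y ys
    using regular_mod_Cons[OF that(1)] that(2,3) mR by blast
  obtain b bs' where bs: "bs = b # bs'"
    using less.prems(4) by (cases bs) auto
  have b: "b \<in> \<mm>" and bs': "set bs' \<subseteq> \<mm>"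
    using less.prems(2) by (auto simp: bs)
  have nzd_b: "nzd_mod R M L b" and reg: "regular_mod R M (add_mult R M L {b}) bs'"
    using less.prems(3) regular_Cons[OF L b bs'] by (auto simp: bs)
  show ?case
  proof (cases bs')
    case Nil
    \<comment> \<open>For \<open>length bs = 1\<close> the empty sequence is wanted; it is regular
      because Nakayama keeps the quotient by \<open>x\<close> nonzero.\<close>
    have "L \<noteq> carrier M"
      using regular_mod_neq_carrier[OF L] less.prems(2,3) maximal_ideal(3) by blast
    then have "regular_mod R M (add_mult R M L {x}) []"
      using regular_mod_Nil[OF sub[OF L x]] add_mult_neq_carrier[OF L x] by simp
    then show ?thesis
      by (intro exI[of _ "[]"]) (simp add: bs Nil)
  next
    case (Cons b2 bs'')
    have b2: "b2 \<in> \<mm>" "nzd_mod R M (add_mult R M L {b}) b2"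
      using reg bs' regular_Cons[OF sub[OF L b], of b2 bs''] by (auto simp: Cons)
    \<comment> \<open>An element killed by \<open>\<mm>\<close> modulo \<open>b\<close> is killed by
      \<open>b2\<close>, which is regular there.\<close>
    have free_b: "n \<in> add_mult R M L {b}"
      if "n \<in> carrier M" "\<And>c. c \<in> \<mm> \<Longrightarrow> c \<odot>\<^bsub>M\<^esub> n \<in> add_mult R M L {b}" for n
      using nzd_modD[OF b2(2) that(1) that(2)[OF b2(1)]] .
    have free_x: "n \<in> add_mult R M L {x}"
      if "n \<in> carrier M" "\<And>c. c \<in> \<mm> \<Longrightarrow> c \<odot>\<^bsub>M\<^esub> n \<in> add_mult R M L {x}" for n
      using socle_free_swap[OF L nzd_b nzd_x b x maximal_ideal(3) free_b] that by blast
    have "\<exists>y\<in>\<mm>. nzd_mod R M (add_mult R M L {b}) y \<and> nzd_mod R M (add_mult R M L {x}) y"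
      by (rule exists_common_nzd[of "{add_mult R M L {b}, add_mult R M L {x}}"])
        (use sub[OF L b] sub[OF L x] free_b free_x in blast)+
    then obtain y where y: "y \<in> \<mm>"
      and nzd_by: "nzd_mod R M (add_mult R M L {b}) y" and nzd_xy: "nzd_mod R M (add_mult R M L {x}) y"
      by blast
    \<comment> \<open>First use of the induction hypothesis, modulo \<open>b\<close>:
      \<open>y\<close> replaces one element of the tail \<open>bs'\<close>.\<close>
    obtain cs where cs: "set cs \<subseteq> \<mm>" "regular_mod R M (add_mult R M (add_mult R M L {b}) {y}) cs"
      "Suc (length cs) = length bs'"
      using less.hyps[OF _ sub[OF L b] bs' reg _ y nzd_by] by (auto simp: bs Cons)
    \<comment> \<open>Modulo \<open>y\<close> the sequence \<open>b # cs\<close> has length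
      \<open>length bs - 1\<close>, so the induction hypothesis applies again, now with
      \<open>x\<close>.\<close>
    have "regular_mod R M (add_mult R M L {y}) (b # cs)"
      using cs(2) nzd_mod_swap[OF L nzd_b nzd_by] comm[OF b y]
        regular_Cons[OF sub[OF L y] b cs(1)] by simp
    moreover have "nzd_mod R M (add_mult R M L {y}) x"
      using nzd_mod_swap[OF L nzd_x nzd_xy] .
    ultimately obtain ds where ds: "set ds \<subseteq> \<mm>" "regular_mod R M (add_mult R M (add_mult R M L {y}) {x}) ds"
      "Suc (length ds) = length (b # cs)"
      using less.hyps[OF _ sub[OF L y], of "b # cs" x] cs(1,3) b x by (auto simp: bs)
    have "regular_mod R M (add_mult R M L {x}) (y # ds)"
      using ds(2) nzd_xy comm[OF x y]
        regular_Cons[OF sub[OF L x] y ds(1)] by simp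
    then show ?thesis
      using ds(1,3) cs(3) y by (intro exI[of _ "y # ds"]) (simp add: bs)
  qed
qed

lemma assoc_mod_lift:
  assumes L: "submodule L R M" and x: "x \<in> \<mm>" "nzd_mod R M L x" and P: "P \<in> assoc_mod R M L"
  obtains Q where "Q \<in> assoc_mod R M (add_mult R M L {x})" "P \<subset> Q"
proof -
  have xR: "x \<in> carrier R"
    using x by (simp add: nzd_mod_def)
  have Lx: "submodule (add_mult R M L {x}) R M"
    using add_mult_submodule L xR by simp
  from P obtain n where n: "n \<in> carrier M" and P_eq: "P = colon R M L n" and prime: "primeideal P R"
    by (auto simp: assoc_mod_def)
  have "n \<notin> L"
    using primeideal.I_notcarr[OF prime] ideal.one_imp_carrier[OF primeideal.axioms(1)[OF prime]]
      one_in_colon_iff[OF n] P_eq by blast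
  \<comment> \<open>The preimage in \<open>M\<close> of the elements of \<open>M / L\<close> killed
    by \<open>P\<close>.\<close>
  define U where "U = {u \<in> carrier M. P \<subseteq> colon R M L u}"
  have "n \<in> U"
    using n by (simp add: U_def P_eq)
  have "\<not> U \<subseteq> add_mult R M L {x}"
  proof
    assume sub: "U \<subseteq> add_mult R M L {x}"
    have "U \<subseteq> L"
    proof (rule nakayama[OF L _ x(1)])
      fix u assume u: "u \<in> U"
      then obtain v where v: "v \<in> carrier M" "u \<ominus>\<^bsub>M\<^esub> x \<odot>\<^bsub>M\<^esub> v \<in> L"
        using add_mult_singleE[OF L xR] sub by blast
      \<comment> \<open>\<open>P\<close> kills \<open>u\<close>, hence \<open>x v\<close>, modulo
        \<open>L\<close>; as \<open>x\<close> is regular, \<open>P\<close> kills \<open>v\<close>.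
        So dividing by \<open>x\<close> does not lead out of \<open>U\<close>.\<close>
      have "c \<odot>\<^bsub>M\<^esub> v \<in> L" if c: "c \<in> P" for c
      proof -
        have cu: "c \<in> carrier R" "c \<odot>\<^bsub>M\<^esub> u \<in> L" and uM: "u \<in> carrier M"
          using u c by (auto simp: U_def colon_def)
        have "c \<odot>\<^bsub>M\<^esub> u \<ominus>\<^bsub>M\<^esub> x \<odot>\<^bsub>M\<^esub> (c \<odot>\<^bsub>M\<^esub> v) \<in> L"
          using submodule_smult[OF L cu(1) v(2)] cu(1) v(1) uM xR
          by (simp add: smult_minus smult_commute[of c x])
        then have "x \<odot>\<^bsub>M\<^esub> (c \<odot>\<^bsub>M\<^esub> v) \<in> L"
          using submodule_minus_iff[OF L, of "x \<odot>\<^bsub>M\<^esub> (c \<odot>\<^bsub>M\<^esub> v)" "c \<odot>\<^bsub>M\<^esub> u"] cu v(1) uM xR by simp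
        then show ?thesis
          using nzd_modD[OF x(2)] cu(1) v(1) by simp
      qed
      moreover have "P \<subseteq> carrier R"
        by (auto simp: P_eq colon_def)
      ultimately have "v \<in> U"
        using v(1) by (auto simp: U_def colon_def)
      then show "\<exists>v\<in>U. u \<ominus>\<^bsub>M\<^esub> x \<odot>\<^bsub>M\<^esub> v \<in> L"
        using v(2) by blast
    qed (auto simp: U_def)
    then show False
      using \<open>n \<in> U\<close> \<open>n \<notin> L\<close> by blast
  qed
  then obtain u where u: "u \<in> carrier M" "P \<subseteq> colon R M L u" "u \<notin> add_mult R M L {x}"
    by (auto simp: U_def)
  obtain Q where Q: "Q \<in> assoc_mod R M (add_mult R M L {x})" "colon R M (add_mult R M L {x}) u \<subseteq> Q"
    using exists_prime_colon[OF noetherian Lx u(1,3)] by blast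
  have "P \<subseteq> Q"
    using u(2) Q(2) add_mult_superset[of L "{x}"] by (auto simp: colon_def)
  moreover have "x \<in> Q"
    using Q(2) smult_in_add_mult[of x "{x}" u] xR u(1) by (auto simp: colon_def)
  moreover have "x \<notin> P"
    using nzd_modD[OF x(2) n] \<open>n \<notin> L\<close> by (auto simp: P_eq colon_def)
  ultimately show thesis
    using that Q(1) by blast
qed

end

section \<open>Depth and initial dimension relative to a submodule\<close>

lemma (in cring) primeideal_image_quot:
  assumes P: "ideal P R" and J: "primeideal J R" "P \<subseteq> J"
  shows "primeideal ((+>) P ` J) (R Quot P)"
proof (rule primeidealI)
  have J': "ideal J R"
    using J(1) by (rule primeideal.axioms)
  \<comment> \<open>Since \<open>P \<subseteq> J\<close>, the cosets of elements of \<open>J\<close>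
    have union \<open>J\<close>, so membership can be tested on a representative.\<close>
  have mem: "P +> a \<in> (+>) P ` J \<longleftrightarrow> a \<in> J" if a: "a \<in> carrier R" for a
  proof
    assume "P +> a \<in> (+>) P ` J"
    moreover have "a \<in> P +> a"
      using abelian_subgroup.a_rcos_self[OF abelian_subgroupI3[OF ideal.axioms(1)[OF P] is_abelian_group] a] .
    ultimately have "a \<in> (\<Union>j\<in>J. P +> j)"
      by blast
    then show "a \<in> J"
      by (rule subsetD[OF equalityD2[OF ideal_incl_iff[OF P J', THEN iffD1, OF J(2)]]])
  qed (rule imageI)
  show "ideal ((+>) P ` J) (R Quot P)"
    by (rule ring_ideal_imp_quot_ideal[OF P J'])
  show "cring (R Quot P)"
    using ideal.quotient_is_cring[OF P is_cring] .
  show "carrier (R Quot P) \<noteq> (+>) P ` J"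
  proof
    assume "carrier (R Quot P) = (+>) P ` J"
    moreover have "P +> \<one> \<in> carrier (R Quot P)"
      using ring_hom_closed[OF ideal.rcos_ring_hom[OF P] one_closed] .
    ultimately have "\<one> \<in> J"
      using mem[OF one_closed] by simp
    then show False
      using primeideal.I_notcarr[OF J(1)] ideal.one_imp_carrier[OF J'] by blast
  qed
  fix A B assume A: "A \<in> carrier (R Quot P)" and B: "B \<in> carrier (R Quot P)"
    and AB: "A \<otimes>\<^bsub>R Quot P\<^esub> B \<in> (+>) P ` J"
  from A B obtain a b where ab: "a \<in> carrier R" "b \<in> carrier R" and A: "A = P +> a" and B: "B = P +> b"
    by (auto simp: FactRing_def A_RCOSETS_def')
  have "P +> (a \<otimes> b) \<in> (+>) P ` J"
    using AB unfolding A B ring_hom_mult[OF ideal.rcos_ring_hom[OF P] ab] .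
  then have "a \<otimes> b \<in> J"
    using mem[of "a \<otimes> b"] ab by blast
  then show "A \<in> (+>) P ` J \<or> B \<in> (+>) P ` J"
    unfolding A B using primeideal.I_prime[OF J(1) ab] by blast
qed

text \<open>Chains of primes are carried along the ideal correspondence, with the union of cosets as
  inverse map. Afterwards the dimensions of different quotients can be compared inside
  \<open>R\<close>.\<close>

lemma (in cring) krull_dim_quot:
  assumes P: "ideal P R"
  shows "krull_dim (R Quot P) = Sup {enat (length Ps - 1) | Ps. prime_chain R Ps \<and> (\<forall>J\<in>set Ps. P \<subseteq> J)}"
proof -
  let ?f = "\<lambda>J. (+>) P ` J"
  have bij: "bij_betw ?f {J. ideal J R \<and> P \<subseteq> J} {J. ideal J (R Quot P)}"
    by (rule quot_ideal_correspondence[OF P])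
  have union_prime: "primeideal (\<Union>K) R \<and> P \<subseteq> \<Union>K \<and> ?f (\<Union>K) = K" if K: "primeideal K (R Quot P)" for K
  proof -
    have iK: "ideal K (R Quot P)"
      using K by (rule primeideal.axioms)
    then have "K \<in> ?f ` {J. ideal J R \<and> P \<subseteq> J}"
      unfolding bij_betw_imp_surj_on[OF bij] by simp
    then obtain J where "J \<in> {J. ideal J R \<and> P \<subseteq> J}" and J3: "K = ?f J"
      by (rule imageE) (rule that)
    then have J: "ideal J R" "P \<subseteq> J"
      by simp_all
    have UK: "\<Union>K = J"
      unfolding J3 by (rule ideal_incl_iff[OF P J(1), THEN iffD1, OF J(2), symmetric])
    have KR: "K \<subseteq> carrier (R Quot P)"
      by (rule additive_subgroup.a_subset[OF ideal.axioms(1)[OF iK]])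
    \<comment> \<open>The union is the preimage of \<open>K\<close> under the projection, and
      preimages of primes are prime.\<close>
    have "\<Union>K = {r \<in> carrier R. P +> r \<in> K}"
    proof (rule Set.set_eqI)
      fix r
      show "r \<in> \<Union>K \<longleftrightarrow> r \<in> {r \<in> carrier R. P +> r \<in> K}"
        using subsetD[OF canonical_proj_vimage_in_carrier[OF P KR], of r]
          canonical_proj_vimage_mem_iff[OF P KR, of r] by auto
    qed
    then have "primeideal (\<Union>K) R"
      using ring_hom_ring.primeideal_vimage[OF ideal.rcos_ring_hom_ring[OF P] is_cring K] by simp
    then show ?thesis
      unfolding UK using J(2) J3[symmetric] by simp
  qed
  have "(\<exists>Ps. prime_chain R Ps \<and> (\<forall>J\<in>set Ps. P \<subseteq> J) \<and> length Ps = n) \<longleftrightarrow>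
      (\<exists>Qs. prime_chain (R Quot P) Qs \<and> length Qs = n)" for n
  proof (intro iffI; elim exE conjE)
    fix Ps assume Ps: "prime_chain R Ps" "\<forall>J\<in>set Ps. P \<subseteq> J" "length Ps = n"
    have "?f I \<subset> ?f J" if IJ: "I \<in> set Ps" "J \<in> set Ps" "I \<subset> J" for I J
    proof -
      have "ideal I R" "ideal J R"
        using IJ Ps(1) primeideal.axioms(1) by (auto simp: prime_chain_def)
      then have "?f I \<noteq> ?f J"
        using inj_on_eq_iff[OF bij_betw_imp_inj_on[OF bij], of I J] IJ Ps(2) by simp
      then show ?thesis
        using IJ(3) image_mono[of I J] by (simp add: psubset_eq)
    qed
    then have "sorted_wrt (\<subset>) (map ?f Ps)"
      using Ps(1) by (intro sorted_wrt_map_mono[of "(\<subset>)"]) (auto simp: prime_chain_def)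
    then have "prime_chain (R Quot P) (map ?f Ps)"
      using Ps(1,2) primeideal_image_quot[OF P] by (simp add: prime_chain_def)
    then show "\<exists>Qs. prime_chain (R Quot P) Qs \<and> length Qs = n"
      using Ps(3) by (intro exI[of _ "map ?f Ps"]) simp
  next
    fix Qs assume Qs: "prime_chain (R Quot P) Qs" "length Qs = n"
    have "\<Union>I \<subset> \<Union>J" if IJ: "I \<in> set Qs" "J \<in> set Qs" "I \<subset> J" for I J
    proof -
      have "primeideal I (R Quot P)" "primeideal J (R Quot P)"
        using IJ Qs(1) by (auto simp: prime_chain_def)
      then have "?f (\<Union>I) = I" "?f (\<Union>J) = J"
        using union_prime by blast+
      then have "\<Union>I \<noteq> \<Union>J"
        using IJ(3) by (metis psubset_eq)
      then show ?thesis
        using IJ(3) Union_mono[of I J] by (simp add: psubset_eq)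
    qed
    then have "sorted_wrt (\<subset>) (map Union Qs)"
      using Qs(1) by (intro sorted_wrt_map_mono[of "(\<subset>)"]) (auto simp: prime_chain_def)
    moreover have "\<forall>K\<in>set Qs. primeideal (\<Union>K) R \<and> P \<subseteq> \<Union>K"
      using Qs(1) union_prime unfolding prime_chain_def by blast
    ultimately have "prime_chain R (map Union Qs)" "\<forall>J\<in>set (map Union Qs). P \<subseteq> J"
      using Qs(1) by (simp_all add: prime_chain_def)
    then show "\<exists>Ps. prime_chain R Ps \<and> (\<forall>J\<in>set Ps. P \<subseteq> J) \<and> length Ps = n"
      using Qs(2) by (intro exI[of _ "map Union Qs"]) simp
  qed
  then have *: "{n. \<exists>Ps. prime_chain R Ps \<and> (\<forall>J\<in>set Ps. P \<subseteq> J) \<and> length Ps = n} =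
      {n. \<exists>Qs. prime_chain (R Quot P) Qs \<and> length Qs = n}"
    by simp
  have "{enat (length Ps - 1) | Ps. prime_chain R Ps \<and> (\<forall>J\<in>set Ps. P \<subseteq> J)} =
      (\<lambda>n. enat (n - 1)) ` {n. \<exists>Ps. prime_chain R Ps \<and> (\<forall>J\<in>set Ps. P \<subseteq> J) \<and> length Ps = n}"
    by blast
  also have "\<dots> = {enat (length Qs - 1) | Qs. prime_chain (R Quot P) Qs}"
    unfolding * by blast
  finally show ?thesis
    by (simp add: krull_dim_def)
qed

text \<open>Prepending \<open>P\<close> to a chain of primes above \<open>Q\<close> gives a longer
  chain above \<open>P\<close>. Working with suprema covers infinite dimension as well.\<close>

lemma (in cring) eSuc_krull_dim_quot_le:
  assumes P: "primeideal P R" and Q: "primeideal Q R" and PQ: "P \<subset> Q"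
  shows "eSuc (krull_dim (R Quot Q)) \<le> krull_dim (R Quot P)"
proof -
  let ?A = "\<lambda>P. {enat (length Ps - 1) | Ps. prime_chain R Ps \<and> (\<forall>J\<in>set Ps. P \<subseteq> J)}"
  have "prime_chain R [Q]"
    using Q by (simp add: prime_chain_def)
  \<comment> \<open>\<open>eSuc\<close> commutes with \<open>Sup\<close> only on nonempty
    sets.\<close>
  then have "?A Q \<noteq> {}"
    by (auto intro!: exI[of _ "[Q]"])
  then have "eSuc (krull_dim (R Quot Q)) = Sup (eSuc ` ?A Q)"
    using krull_dim_quot[OF primeideal.axioms(1)[OF Q]] by (simp add: eSuc_Sup)
  also have "\<dots> \<le> Sup (?A P)"
  proof (rule Sup_subset_mono, rule image_subsetI)
    fix n assume "n \<in> ?A Q"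
    then obtain Ps where Ps: "prime_chain R Ps" "\<forall>J\<in>set Ps. Q \<subseteq> J" "n = enat (length Ps - 1)"
      by blast
    then have "prime_chain R (P # Ps)" "\<forall>J\<in>set (P # Ps). P \<subseteq> J"
      using P PQ by (auto simp: prime_chain_def)
    moreover have "eSuc n = enat (length (P # Ps) - 1)"
      using Ps by (auto simp: prime_chain_def eSuc_enat)
    ultimately show "eSuc n \<in> ?A P"
      by blast
  qed
  also have "\<dots> = krull_dim (R Quot P)"
    using krull_dim_quot[OF primeideal.axioms(1)[OF P]] by simp
  finally show ?thesis .
qed

section \<open>Depth and initial dimension along a regular sequence\<close>

context noetherian_local_module
begin

text \<open>There is no special case for the zero quotient: for \<open>L = carrier M\<close> the set
  is empty and the value is 0, whereas \<open>depth\<close> gives \<infinity>. The two agree for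
  proper \<open>L\<close>.\<close>

definition depth_mod :: "'c set \<Rightarrow> enat" where
  "depth_mod L = Sup {enat (length bs) | bs. set bs \<subseteq> \<mm> \<and> regular_mod R M L bs}"

definition indim_mod :: "'c set \<Rightarrow> enat" where
  "indim_mod L = Inf {krull_dim (R Quot P) | P. P \<in> assoc_mod R M L}"

text \<open>The exchange lemma turns a nonempty regular sequence modulo \<open>L\<close> into one
  modulo \<open>x\<close> that is shorter by one; conversely, \<open>x\<close> can be
  prepended.\<close>

lemma depth_mod_step:
  assumes L: "submodule L R M" and x: "x \<in> \<mm>" "nzd_mod R M L x" and neq: "L \<noteq> carrier M"
  shows "depth_mod L = eSuc (depth_mod (add_mult R M L {x}))"
proof -
  let ?A = "\<lambda>L. {enat (length bs) | bs. set bs \<subseteq> \<mm> \<and> regular_mod R M L bs}"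
  have xR: "x \<in> carrier R"
    using x maximal_ideal by blast
  have Lx: "submodule (add_mult R M L {x}) R M"
    using add_mult_submodule L xR by simp
  have "regular_mod R M (add_mult R M L {x}) []"
    using regular_mod_Nil[OF Lx] add_mult_neq_carrier[OF L x(1) neq] by simp
  then have ne: "?A (add_mult R M L {x}) \<noteq> {}"
    by (auto intro!: exI[of _ "[]"])
  have "Sup (?A L) = Sup (eSuc ` ?A (add_mult R M L {x}))"
  proof (rule antisym; rule Sup_least)
    fix n assume "n \<in> ?A L"
    then obtain bs where bs: "set bs \<subseteq> \<mm>" "regular_mod R M L bs" "n = enat (length bs)"
      by blast
    show "n \<le> Sup (eSuc ` ?A (add_mult R M L {x}))"
    proof (cases "bs = []")
      case False
      then obtain cs where cs: "set cs \<subseteq> \<mm>" "regular_mod R M (add_mult R M L {x}) cs" "Suc (length cs) = length bs"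
        using regular_mod_exchange[OF L bs(1,2) _ x] by blast
      then have "n = eSuc (enat (length cs))"
        using bs(3) by (simp add: eSuc_enat)
      then show ?thesis
        using cs(1,2) by (intro Sup_upper) blast
    qed (use bs in \<open>simp add: zero_enat_def[symmetric]\<close>)
  next
    fix n assume "n \<in> eSuc ` ?A (add_mult R M L {x})"
    then obtain bs where bs: "set bs \<subseteq> \<mm>" "regular_mod R M (add_mult R M L {x}) bs" "n = eSuc (enat (length bs))"
      by blast
    then have "regular_mod R M L (x # bs)"
      using regular_mod_Cons[OF L xR] x(2) maximal_ideal(3) by blast
    moreover have "n = enat (length (x # bs))"
      using bs(3) by (simp add: eSuc_enat)
    ultimately show "n \<le> Sup (?A L)"
      using bs(1) x(1) by (intro Sup_upper) (auto intro!: exI[of _ "x # bs"])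
  qed
  then show ?thesis
    using eSuc_Sup[OF ne] by (simp add: depth_mod_def)
qed

text \<open>Each associated prime lies strictly below one of the quotient by \<open>x\<close>, and a
  strict inclusion of primes costs at least one dimension.\<close>

lemma indim_mod_step:
  assumes L: "submodule L R M" and x: "x \<in> \<mm>" "nzd_mod R M L x"
  shows "eSuc (indim_mod (add_mult R M L {x})) \<le> indim_mod L"
  unfolding indim_mod_def[of L]
proof (rule Inf_greatest)
  fix d assume "d \<in> {krull_dim (R Quot P) | P. P \<in> assoc_mod R M L}"
  then obtain P where P: "P \<in> assoc_mod R M L" "d = krull_dim (R Quot P)"
    by blast
  obtain Q where Q: "Q \<in> assoc_mod R M (add_mult R M L {x})" "P \<subset> Q"
    by (rule assoc_mod_lift[OF L x P(1)])
  have "indim_mod (add_mult R M L {x}) \<le> krull_dim (R Quot Q)"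
    unfolding indim_mod_def using Q(1) by (intro Inf_lower) blast
  then have "eSuc (indim_mod (add_mult R M L {x})) \<le> eSuc (krull_dim (R Quot Q))"
    by simp
  also have "\<dots> \<le> d"
    unfolding P(2) using P(1) Q by (intro R.eSuc_krull_dim_quot_le) (auto simp: assoc_mod_def)
  finally show "eSuc (indim_mod (add_mult R M L {x})) \<le> d" .
qed

lemma regular_mod_depth_indim:
  assumes "submodule L R M" "set as \<subseteq> \<mm>" "regular_mod R M L as"
  shows "depth_mod L = depth_mod (add_mult R M L (set as)) + enat (length as) \<and>
    indim_mod (add_mult R M L (set as)) + enat (length as) \<le> indim_mod L"
  using assms
proof (induction as arbitrary: L)
  case Nil
  then show ?case
    by (simp add: add_mult_empty zero_enat_def[symmetric])
next
  case (Cons x as)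
  note L = Cons.prems(1)
  have x: "x \<in> \<mm>" and as: "set as \<subseteq> \<mm>" and xR: "x \<in> carrier R" and asR: "set as \<subseteq> carrier R"
    using Cons.prems(2) maximal_ideal(3) by auto
  have Lx: "submodule (add_mult R M L {x}) R M"
    using add_mult_submodule L xR by simp
  have nzd: "nzd_mod R M L x" and reg: "regular_mod R M (add_mult R M L {x}) as"
    using Cons.prems(3) regular_mod_Cons[OF L xR asR] by auto
  have neq: "L \<noteq> carrier M"
    using regular_mod_neq_carrier[OF L _ Cons.prems(3)] xR asR by simp
  have eq: "add_mult R M L (set (x # as)) = add_mult R M (add_mult R M L {x}) (set as)"
    using add_mult_insert[OF L xR asR] by simp
  note IH = Cons.IH[OF Lx as reg]
  have "depth_mod L = eSuc (depth_mod (add_mult R M L (set (x # as))) + enat (length as))"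
    unfolding eq using depth_mod_step[OF L x nzd neq] IH by simp
  moreover have "eSuc (indim_mod (add_mult R M L (set (x # as))) + enat (length as)) \<le> indim_mod L"
    using indim_mod_step[OF L x nzd] IH unfolding eq by (meson eSuc_ile_mono order_trans)
  ultimately show ?case
    by (simp add: eSuc_enat[symmetric] iadd_Suc_right)
qed

lemma depth_mod_le_indim_mod:
  assumes L: "submodule L R M"
  shows "depth_mod L \<le> indim_mod L"
  unfolding depth_mod_def
proof (rule Sup_least)
  fix n assume "n \<in> {enat (length bs) | bs. set bs \<subseteq> \<mm> \<and> regular_mod R M L bs}"
  then obtain bs where bs: "set bs \<subseteq> \<mm>" "regular_mod R M L bs" "n = enat (length bs)"
    by blast
  \<comment> \<open>Discarding the initial dimension of the quotient leaves just the length of the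
    sequence.\<close>
  have "n \<le> indim_mod (add_mult R M L (set bs)) + n"
    by simp
  then show "n \<le> indim_mod L"
    using regular_mod_depth_indim[OF L bs(1,2)] bs(3) by (meson order_trans)
qed

end

section \<open>Quotient modules\<close>

context module
begin

lemma carrier_quot_module: "carrier (quot_module R M L) = (\<lambda>n. L +>\<^bsub>M\<^esub> n) ` carrier M"
  by (auto simp: quot_module_def A_RCOSETS_def')

lemma zero_quot_module: "\<zero>\<^bsub>quot_module R M L\<^esub> = L"
  by (simp add: quot_module_def)

context
  fixes L
  assumes L: "submodule L R M"
begin

lemma submodule_abelian_subgroup: "abelian_subgroup L M"
  by (rule abelian_subgroupI3[OF additive_subgroup.intro[OF submodule.axioms(1)[OF L]] M.abelian_group_axioms])

interpretation L: abelian_subgroup L M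
  by (rule submodule_abelian_subgroup)

lemma coset_eq_iff:
  assumes "m \<in> carrier M" "n \<in> carrier M"
  shows "L +>\<^bsub>M\<^esub> m = L +>\<^bsub>M\<^esub> n \<longleftrightarrow> m \<ominus>\<^bsub>M\<^esub> n \<in> L"
proof
  show "m \<ominus>\<^bsub>M\<^esub> n \<in> L" if "L +>\<^bsub>M\<^esub> m = L +>\<^bsub>M\<^esub> n"
    using L.a_rcos_self[OF assms(1)] unfolding that a_minus_def L.a_rcos_module[OF assms(2,1)] .
  show "L +>\<^bsub>M\<^esub> m = L +>\<^bsub>M\<^esub> n" if "m \<ominus>\<^bsub>M\<^esub> n \<in> L"
    using that unfolding a_minus_def L.a_rcos_module[OF assms(2,1), symmetric]
    by (rule L.a_repr_independence'[OF _ assms(2), symmetric])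
qed

lemma coset_eq_self_iff: "n \<in> carrier M \<Longrightarrow> L +>\<^bsub>M\<^esub> n = L \<longleftrightarrow> n \<in> L"
  using L.a_rcos_self[of n] L.a_rcos_const[of n] by auto

lemma add_quot_module:
  "m \<in> carrier M \<Longrightarrow> n \<in> carrier M \<Longrightarrow>
    (L +>\<^bsub>M\<^esub> m) \<oplus>\<^bsub>quot_module R M L\<^esub> (L +>\<^bsub>M\<^esub> n) = L +>\<^bsub>M\<^esub> (m \<oplus>\<^bsub>M\<^esub> n)"
  by (simp add: quot_module_def L.a_rcos_sum)

text \<open>The union defining \<open>smult\<close> runs over equal cosets, because \<open>x\<close>
  maps \<open>L\<close> into itself.\<close>

lemma smult_quot_module:
  assumes x: "x \<in> carrier R" and n: "n \<in> carrier M"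
  shows "x \<odot>\<^bsub>quot_module R M L\<^esub> (L +>\<^bsub>M\<^esub> n) = L +>\<^bsub>M\<^esub> (x \<odot>\<^bsub>M\<^esub> n)"
proof -
  have "L +>\<^bsub>M\<^esub> (x \<odot>\<^bsub>M\<^esub> m) = L +>\<^bsub>M\<^esub> (x \<odot>\<^bsub>M\<^esub> n)" if m: "m \<in> L +>\<^bsub>M\<^esub> n" for m
  proof -
    have mM: "m \<in> carrier M"
      using L.a_elemrcos_carrier[OF n m] .
    have "m \<ominus>\<^bsub>M\<^esub> n \<in> L"
      using L.a_rcos_module[OF n mM] m by (simp add: a_minus_def)
    then have "x \<odot>\<^bsub>M\<^esub> m \<ominus>\<^bsub>M\<^esub> x \<odot>\<^bsub>M\<^esub> n \<in> L"
      unfolding smult_minus[OF x mM n, symmetric] by (rule submodule_smult[OF L x])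
    then show ?thesis
      using coset_eq_iff x mM n by simp
  qed
  then have "(\<Union>m\<in>L +>\<^bsub>M\<^esub> n. L +>\<^bsub>M\<^esub> (x \<odot>\<^bsub>M\<^esub> m)) = L +>\<^bsub>M\<^esub> (x \<odot>\<^bsub>M\<^esub> n)"
    by (intro UN_constant_eq[OF L.a_rcos_self[OF n]]) blast
  then show ?thesis
    by (simp add: quot_module_def)
qed

lemma module_quot_module: "module R (quot_module R M L)"
proof (rule moduleI)
  show "abelian_group (quot_module R M L)"
  proof (rule abelian_groupI)
    have zero: "\<zero>\<^bsub>quot_module R M L\<^esub> = L +>\<^bsub>M\<^esub> \<zero>\<^bsub>M\<^esub>"
      using coset_eq_self_iff[of "\<zero>\<^bsub>M\<^esub>"] submodule_zero[OF L] by (simp add: zero_quot_module)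
    then show "\<zero>\<^bsub>quot_module R M L\<^esub> \<in> carrier (quot_module R M L)"
      by (auto simp: carrier_quot_module)
    fix C assume "C \<in> carrier (quot_module R M L)"
    then obtain n where n: "n \<in> carrier M" and C: "C = L +>\<^bsub>M\<^esub> n"
      by (auto simp: carrier_quot_module)
    show "\<zero>\<^bsub>quot_module R M L\<^esub> \<oplus>\<^bsub>quot_module R M L\<^esub> C = C"
      unfolding zero C using n by (simp add: add_quot_module)
    have "(L +>\<^bsub>M\<^esub> (\<ominus>\<^bsub>M\<^esub> n)) \<oplus>\<^bsub>quot_module R M L\<^esub> C = \<zero>\<^bsub>quot_module R M L\<^esub>"
      unfolding zero C using n by (simp add: add_quot_module M.l_neg)
    then show "\<exists>D\<in>carrier (quot_module R M L). D \<oplus>\<^bsub>quot_module R M L\<^esub> C = \<zero>\<^bsub>quot_module R M L\<^esub>"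
      using n by (intro bexI) (auto simp: carrier_quot_module)
  qed (auto simp: carrier_quot_module add_quot_module M.a_ac)
qed (use R.is_cring in \<open>auto simp: carrier_quot_module add_quot_module smult_quot_module
  smult_l_distr smult_r_distr smult_assoc1\<close>)

lemma nonzerodivisor_on_quot_module:
  "nonzerodivisor_on R (quot_module R M L) x \<longleftrightarrow> nzd_mod R M L x"
  by (simp add: nonzerodivisor_on_def nzd_mod_def carrier_quot_module zero_quot_module
    smult_quot_module coset_eq_self_iff cong: conj_cong ball_cong)

lemma zero_module_quot_module: "zero_module (quot_module R M L) \<longleftrightarrow> L = carrier M"
proof -
  have "zero_module (quot_module R M L) \<longleftrightarrow> (\<lambda>n. L +>\<^bsub>M\<^esub> n) ` carrier M \<subseteq> {L}"
    unfolding zero_module_def carrier_quot_module zero_quot_module subset_singleton_iff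
    using M.zero_closed by blast
  also have "\<dots> \<longleftrightarrow> carrier M \<subseteq> L"
    by (auto simp: image_subset_iff coset_eq_self_iff)
  finally show ?thesis
    using submoduleE(1)[OF L] by blast
qed

lemma Ass_quot_module: "Ass R (quot_module R M L) = assoc_mod R M L"
proof -
  have "annihilator R (quot_module R M L) (L +>\<^bsub>M\<^esub> n) = colon R M L n" if "n \<in> carrier M" for n
    using that by (simp add: annihilator_def colon_def zero_quot_module smult_quot_module
      coset_eq_self_iff cong: conj_cong)
  then show ?thesis
    by (simp add: Ass_def assoc_mod_def carrier_quot_module cong: bex_cong)
qed

text \<open>The correspondence between submodules of \<open>M / L\<close> and those above
  \<open>L\<close>, with \<open>{L}\<close> as the zero submodule of the quotient. Minimality of the
  two spans gives the two directions: one sits in the image of the other, the other in the preimage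
  of the first.\<close>

lemma coset_in_add_mult_iff:
  assumes A: "A \<subseteq> carrier R" and n: "n \<in> carrier M"
  shows "L +>\<^bsub>M\<^esub> n \<in> add_mult R (quot_module R M L) {L} A \<longleftrightarrow> n \<in> add_mult R M L A"
proof -
  let ?Q = "quot_module R M L"
  let ?p = "\<lambda>n. L +>\<^bsub>M\<^esub> n"
  let ?U = "add_mult R M L A" and ?V = "add_mult R ?Q {L} A"
  interpret Q: module R ?Q
    by (rule module_quot_module)
  have U: "submodule ?U R M"
    by (rule add_mult_submodule[OF L A])
  have V: "submodule ?V R ?Q"
    using Q.add_mult_submodule[OF Q.submodule_zero_module A] by (simp add: zero_quot_module)
  have uminus: "\<ominus>\<^bsub>?Q\<^esub> ?p m = ?p (\<ominus>\<^bsub>M\<^esub> m)" if m: "m \<in> carrier M" for m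
    using m by (intro Q.minus_equality)
      (simp_all add: carrier_quot_module add_quot_module zero_quot_module M.l_neg coset_eq_self_iff submodule_zero[OF L])
  note cU = submodule_carrier[OF U]
  have imU: "submodule (?p ` ?U) R ?Q"
  proof (rule Q.submoduleI)
    show "?p ` ?U \<subseteq> carrier ?Q"
      using cU by (auto simp: carrier_quot_module)
    show "\<zero>\<^bsub>?Q\<^esub> \<in> ?p ` ?U"
      using submodule_zero[OF U] coset_eq_self_iff[of "\<zero>\<^bsub>M\<^esub>"] submodule_zero[OF L]
      by (auto simp: zero_quot_module intro!: image_eqI[of _ _ "\<zero>\<^bsub>M\<^esub>"])
    show "\<ominus>\<^bsub>?Q\<^esub> a \<in> ?p ` ?U" if "a \<in> ?p ` ?U" for a
      using that cU submodule_uminus[OF U] by (auto simp: uminus)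
    show "a \<oplus>\<^bsub>?Q\<^esub> b \<in> ?p ` ?U" if "a \<in> ?p ` ?U" "b \<in> ?p ` ?U" for a b
      using that cU submodule_add[OF U] by (auto simp: add_quot_module)
    show "c \<odot>\<^bsub>?Q\<^esub> a \<in> ?p ` ?U" if "c \<in> carrier R" "a \<in> ?p ` ?U" for c a
      using that cU submodule_smult[OF U] by (auto simp: smult_quot_module)
  qed
  have zero: "?p \<zero>\<^bsub>M\<^esub> = \<zero>\<^bsub>?Q\<^esub>"
    using coset_eq_self_iff[of "\<zero>\<^bsub>M\<^esub>"] submodule_zero[OF L] by (simp add: zero_quot_module)
  have preV: "submodule {m \<in> carrier M. ?p m \<in> ?V} R M"
    using Q.submodule_zero[OF V] Q.submodule_uminus[OF V] Q.submodule_add[OF V]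
      Q.submodule_smult[OF V]
    by (intro submoduleI) (auto simp: zero simp flip: uminus add_quot_module smult_quot_module)
  show ?thesis
  proof
    assume "?p n \<in> ?V"
    also have "?V \<subseteq> ?p ` ?U"
    proof (rule Q.add_mult_least[OF imU])
      show "{L} \<subseteq> ?p ` ?U"
        using Q.submodule_zero[OF imU] by (simp add: zero_quot_module)
      show "a \<odot>\<^bsub>?Q\<^esub> C \<in> ?p ` ?U" if "a \<in> A" "C \<in> carrier ?Q" for a C
        using that A smult_in_add_mult[of a A _ L] by (auto simp: carrier_quot_module smult_quot_module)
    qed
    finally obtain m where m: "m \<in> ?U" "?p n = ?p m"
      by blast
    then have "n \<ominus>\<^bsub>M\<^esub> m \<in> ?U"
      using coset_eq_iff[OF n] cU add_mult_superset[of L A] by blast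
    then show "n \<in> ?U"
      using submodule_minus_iff[OF U cU n] m(1) by blast
  next
    assume "n \<in> ?U"
    also have "?U \<subseteq> {m \<in> carrier M. ?p m \<in> ?V}"
    proof (rule add_mult_least[OF preV])
      show "L \<subseteq> {m \<in> carrier M. ?p m \<in> ?V}"
        using submodule_carrier[OF L] Q.submodule_zero[OF V]
        by (auto simp: zero_quot_module coset_eq_self_iff[THEN iffD2])
      show "a \<odot>\<^bsub>M\<^esub> m \<in> {m \<in> carrier M. ?p m \<in> ?V}" if "a \<in> A" "m \<in> carrier M" for a m
        using that A Q.smult_in_add_mult[of a A "?p m" "{L}"]
        by (auto simp: carrier_quot_module smult_quot_module)
    qed
    finally show "?p n \<in> ?V"
      by blast
  qed
qed

text \<open>Brings regular sequences on \<open>M / L\<close>, whose definition involves quotients of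
  quotients, back to \<open>M\<close>.\<close>

lemma regular_mod_quot_module:
  assumes "set bs \<subseteq> carrier R"
  shows "regular_mod R (quot_module R M L) {L} bs \<longleftrightarrow> regular_mod R M L bs"
proof -
  let ?Q = "quot_module R M L"
  interpret Q: module R ?Q
    by (rule module_quot_module)
  have nzd: "nzd_mod R ?Q (add_mult R ?Q {L} A) x \<longleftrightarrow> nzd_mod R M (add_mult R M L A) x" if "A \<subseteq> carrier R" for A x
    using coset_in_add_mult_iff[OF that] by (auto simp: nzd_mod_def carrier_quot_module smult_quot_module)
  have "add_mult R ?Q {L} A = carrier ?Q \<longleftrightarrow> add_mult R M L A = carrier M" if A: "A \<subseteq> carrier R" for A
  proof -
    have "add_mult R ?Q {L} A \<subseteq> carrier ?Q"
      using Q.submoduleE(1)[OF Q.add_mult_submodule[OF Q.submodule_zero_module A]] by (simp add: zero_quot_module)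
    moreover have "add_mult R M L A \<subseteq> carrier M"
      using submoduleE(1)[OF add_mult_submodule[OF L A]] .
    moreover have "carrier ?Q \<subseteq> add_mult R ?Q {L} A \<longleftrightarrow> carrier M \<subseteq> add_mult R M L A"
      using coset_in_add_mult_iff[OF A] by (auto simp: carrier_quot_module)
    ultimately show ?thesis
      by blast
  qed
  moreover have "set (take i bs) \<subseteq> carrier R" for i
    using assms set_take_subset by fastforce
  ultimately show ?thesis
    unfolding regular_mod_def using nzd assms by simp
qed

end

section \<open>Translation of the original notions\<close>

lemma ideal_smult_genideal:
  assumes A: "A \<subseteq> carrier R"
  shows "ideal_smult R (Idl A) M = add_mult R M {\<zero>\<^bsub>M\<^esub>} A"
proof
  let ?U = "add_mult R M {\<zero>\<^bsub>M\<^esub>} A"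
  have U: "submodule ?U R M"
    by (rule add_mult_submodule[OF submodule_zero_module A])
  \<comment> \<open>The ring elements that map all of \<open>M\<close> into \<open>?U\<close> form
    an ideal. It contains \<open>A\<close>, hence \<open>Idl A\<close>.\<close>
  have "ideal (\<Inter>n\<in>carrier M. colon R M ?U n) R"
    using R.i_Intersect[of "colon R M ?U ` carrier M"] ideal_colon[OF U] M.zero_closed by blast
  then have "Idl A \<subseteq> (\<Inter>n\<in>carrier M. colon R M ?U n)"
    using A smult_in_add_mult[of _ A] by (intro R.genideal_minimal) (auto simp: colon_def)
  then show "ideal_smult R (Idl A) M \<subseteq> ?U"
    unfolding ideal_smult_def by (intro module_span_least U) (auto simp: colon_def)
  have "Idl A \<subseteq> carrier R"
    using ideal.Icarr[OF R.genideal_ideal[OF A]] by blast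
  then have S: "{x \<odot>\<^bsub>M\<^esub> n | x n. x \<in> Idl A \<and> n \<in> carrier M} \<subseteq> carrier M"
    by auto
  have sub: "submodule (ideal_smult R (Idl A) M) R M"
    unfolding ideal_smult_def by (rule module_span_submodule[OF S])
  have "a \<odot>\<^bsub>M\<^esub> n \<in> ideal_smult R (Idl A) M" if "a \<in> A" "n \<in> carrier M" for a n
    unfolding ideal_smult_def using that R.genideal_self[OF A]
    by (intro subsetD[OF module_span_superset]) auto
  then show "?U \<subseteq> ideal_smult R (Idl A) M"
    using submodule_zero[OF sub] by (intro add_mult_least sub) auto
qed

lemma quot_seq_eq:
  "set as \<subseteq> carrier R \<Longrightarrow> quot_seq R M as = quot_module R M (add_mult R M {\<zero>\<^bsub>M\<^esub>} (set as))"
  by (simp add: quot_seq_def ideal_smult_genideal)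

lemma regular_seq_iff:
  assumes as: "set as \<subseteq> carrier R"
  shows "regular_seq R M as \<longleftrightarrow> regular_mod R M {\<zero>\<^bsub>M\<^esub>} as"
proof -
  have take: "set (take i as) \<subseteq> carrier R" for i
    using as set_take_subset by fastforce
  note sub = add_mult_submodule[OF submodule_zero_module]
  show ?thesis
    unfolding regular_seq_def regular_mod_def
    using nonzerodivisor_on_quot_module[OF sub[OF take]] zero_module_quot_module[OF sub[OF as]]
    by (simp add: quot_seq_eq take as)
qed

lemma Ass_eq: "Ass R M = assoc_mod R M {\<zero>\<^bsub>M\<^esub>}"
  by (simp add: Ass_def assoc_mod_def annihilator_def colon_def)

end

context noetherian_local_module
begin

lemma depth_eq:
  assumes "\<not> zero_module M"
  shows "depth R \<mm> M = depth_mod {\<zero>\<^bsub>M\<^esub>}"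
proof -
  have "set bs \<subseteq> \<mm> \<and> regular_seq R M bs \<longleftrightarrow> set bs \<subseteq> \<mm> \<and> regular_mod R M {\<zero>\<^bsub>M\<^esub>} bs" for bs
    using regular_seq_iff[of bs] maximal_ideal(3) by auto
  then show ?thesis
    using assms by (simp add: depth_def depth_mod_def)
qed

lemma depth_quot_module:
  assumes L: "submodule L R M" and neq: "L \<noteq> carrier M"
  shows "depth R \<mm> (quot_module R M L) = depth_mod L"
proof -
  interpret Q: module R "quot_module R M L"
    by (rule module_quot_module[OF L])
  have "set bs \<subseteq> \<mm> \<and> regular_seq R (quot_module R M L) bs \<longleftrightarrow> set bs \<subseteq> \<mm> \<and> regular_mod R M L bs" for bs
    using Q.regular_seq_iff[of bs] regular_mod_quot_module[OF L, of bs] maximal_ideal(3)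
    by (auto simp: zero_quot_module)
  then show ?thesis
    using zero_module_quot_module[OF L] neq by (simp add: depth_def depth_mod_def)
qed

lemma indim_eq: "indim R M = indim_mod {\<zero>\<^bsub>M\<^esub>}"
  by (simp add: indim_def indim_mod_def Ass_eq)

lemma indim_quot_module: "submodule L R M \<Longrightarrow> indim R (quot_module R M L) = indim_mod L"
  by (simp add: indim_def indim_mod_def Ass_quot_module)

lemma initially_CM_iff:
  assumes as: "set as \<subseteq> \<mm>" and reg: "regular_seq R M as"
  shows "initially_CM R \<mm> M \<longleftrightarrow>
    initially_CM R \<mm> (quot_seq R M as) \<and>
    ereal_of_enat (indim R (quot_seq R M as)) = ereal_of_enat (indim R M) - ereal (real (length as))"
proof -
  define K where "K = add_mult R M {\<zero>\<^bsub>M\<^esub>} (set as)"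
  have asR: "set as \<subseteq> carrier R"
    using as maximal_ideal(3) by blast
  note Z = submodule_zero_module
  have K: "submodule K R M"
    unfolding K_def by (rule add_mult_submodule[OF Z asR])
  have Q: "quot_seq R M as = quot_module R M K"
    unfolding K_def by (rule quot_seq_eq[OF asR])
  have reg': "regular_mod R M {\<zero>\<^bsub>M\<^esub>} as"
    using reg regular_seq_iff[OF asR] by simp
  have KM: "K \<noteq> carrier M"
    using reg' by (simp add: regular_mod_def K_def)
  then have nzQ: "\<not> zero_module (quot_module R M K)"
    using zero_module_quot_module[OF K] by simp
  have nz: "\<not> zero_module M"
    using regular_mod_neq_carrier[OF Z asR reg'] by (simp add: zero_module_def)
  have depth: "depth_mod {\<zero>\<^bsub>M\<^esub>} = depth_mod K + enat (length as)"
    and indim: "indim_mod K + enat (length as) \<le> indim_mod {\<zero>\<^bsub>M\<^esub>}"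
    using regular_mod_depth_indim[OF Z as reg'] by (simp_all add: K_def)
  \<comment> \<open>The subtrahend is finite, so the subtraction becomes an addition in
    \<open>enat\<close> even for infinite values.\<close>
  have "ereal_of_enat i = ereal_of_enat j - ereal (real n) \<longleftrightarrow> j = i + enat n" for i j n
    by (cases i; cases j) auto
  \<comment> \<open>With \<open>r = length as\<close>, the depth of \<open>M\<close> equals
    \<open>depth_mod K + r \<le> indim_mod K + r\<close>, which is at most the initial dimension of
    \<open>M\<close>. The outer terms agree iff both inequalities are equalities, and the finite
    \<open>r\<close> cancels.\<close>
  moreover have "depth_mod {\<zero>\<^bsub>M\<^esub>} = indim_mod {\<zero>\<^bsub>M\<^esub>} \<longleftrightarrow>
      depth_mod K = indim_mod K \<and> indim_mod {\<zero>\<^bsub>M\<^esub>} = indim_mod K + enat (length as)"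
    using depth indim depth_mod_le_indim_mod[OF K]
    by (cases "depth_mod K"; cases "indim_mod K"; cases "indim_mod {\<zero>\<^bsub>M\<^esub>}") auto
  ultimately show ?thesis
    using nz nzQ KM
    by (simp add: initially_CM_def Q depth_eq depth_quot_module[OF K] indim_eq indim_quot_module[OF K])
qed

end

theorem proposition3p22:
  fixes R :: "('a, 'r) ring_scheme" and M :: "'a set"
    and N :: "('a, 'b, 'n) module_scheme" and as :: "'a list"
  assumes "noetherian_ring R" and "local_ring R M"
    and "fin_gen_module R N"
    and "set as \<subseteq> M" and "regular_seq R N as"
  shows "initially_CM R M N \<longleftrightarrow>
           initially_CM R M (quot_seq R N as) \<and>
           ereal_of_enat (indim R (quot_seq R N as)) =
             ereal_of_enat (indim R N) - ereal (real (length as))"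
proof -
  \<comment> \<open>The module and the maximal ideal, called \<open>M\<close> and
    \<open>\<mm>\<close> in the locale, are \<open>N\<close> and \<open>M\<close> here.\<close>
  interpret noetherian_local_module R N M
    using assms(1-3)
    by (simp add: noetherian_local_module_def noetherian_local_module_axioms_def fin_gen_module_def)
  show ?thesis
    by (rule initially_CM_iff[OF assms(4,5)])
qed

end
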